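(* Let $N\ge1$ be an integer, $1<p<2$, $\delta=\frac{p}{2-p}$, $\eta=\frac{N-p}{p-1}$, and $q^\ast=\frac{N(p-1)+p}{N-p}$ if $p<N$, $q^\ast=\infty$ if $N\le p$. Assume $\delta<\alpha<N$ and $1<q<q^\ast$. For $a\in\mathbb{R}$ let $w(\cdot,a)$ be the solution of $$(|w'|^{p-2}w')'+\frac{N-1}{r}|w'|^{p-2}w'+rw'+\alpha w+|w|^{q-1}w=0\ \text{ in }(0,\infty),\qquad w(0)=a,\quad w'(0)=0.$$ Then there exists $a>0$ such that $w(\cdot,a)$ is positive and satisfies $\lim_{r\to\infty}r^\eta w(r,a)=c$ for some $c\ne0$.
   Context: For every $a\in\mathbb{R}$ the initial value problem has a unique solution $w(\cdot,a)\in C^1([0,\infty))$ with $|w'|^{p-2}w'\in C^1([0,\infty))$. *)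

theory Defs
  imports "HOL-Analysis.Analysis"
begin

definition delta_exp :: "real \<Rightarrow> real" where
  "delta_exp p = p / (2 - p)"

definition eta_exp :: "nat \<Rightarrow> real \<Rightarrow> real" where
  "eta_exp N p = (real N - p) / (p - 1)"

definition q_star :: "nat \<Rightarrow> real \<Rightarrow> ereal" where
  "q_star N p = (if p < real N then ereal ((real N * (p - 1) + p) / (real N - p)) else \<infinity>)"

text \<open>
  The map taking \<open>x\<close> to \<open>\<bar>x\<bar>\<^sup>m\<^sup>-\<^sup>1 x\<close>.  Since \<open>0 powr b = 0\<close>, it vanishes at \<open>0\<close> for every \<open>m\<close>,
  which for \<open>m > 0\<close> is its continuous extension.  The terms \<open>\<bar>w'\<bar>\<^sup>p\<^sup>-\<^sup>2 w'\<close> and \<open>\<bar>w\<bar>\<^sup>q\<^sup>-\<^sup>1 w\<close> are the cases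
  \<open>m = p - 1\<close> and \<open>m = q\<close>.
\<close>

definition signed_pow :: "real \<Rightarrow> real \<Rightarrow> real" where
  "signed_pow m x = \<bar>x\<bar> powr (m - 1) * x"

text \<open>
  Only the values of \<open>w\<close> on \<open>[0, \<infinity>)\<close> matter: derivatives are taken within \<open>{0..}\<close>, so they are
  one-sided at \<open>0\<close>.  The witnesses \<open>dw\<close> and \<open>dF\<close> are the continuous derivatives of \<open>w\<close> and of the
  flux \<open>\<bar>w'\<bar>\<^sup>p\<^sup>-\<^sup>2 w'\<close>.
\<close>

definition ivp_solution ::
  "nat \<Rightarrow> real \<Rightarrow> real \<Rightarrow> real \<Rightarrow> real \<Rightarrow> (real \<Rightarrow> real) \<Rightarrow> bool" where
  "ivp_solution N p q \<alpha> a w \<longleftrightarrow>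
     (\<exists>dw dF.
        (\<forall>r\<ge>0. (w has_real_derivative dw r) (at r within {0..})) \<and>
        continuous_on {0..} dw \<and>
        (\<forall>r\<ge>0. ((\<lambda>s. signed_pow (p - 1) (dw s)) has_real_derivative dF r) (at r within {0..})) \<and>
        continuous_on {0..} dF \<and>
        (\<forall>r>0. dF r + (real N - 1) / r * signed_pow (p - 1) (dw r)
                 + r * dw r + \<alpha> * w r + signed_pow q (w r) = 0) \<and>
        w 0 = a \<and> dw 0 = 0)"

end

theory Submission
  imports Defs
begin

text \<open>
  Write \<open>F\<close> for the flux \<open>\<bar>w'\<bar>\<^sup>p\<^sup>-\<^sup>2 w'\<close>.  The quantity \<open>J(r) = r\<^sup>N\<^sup>-\<^sup>1 (F + r w)\<close> satisfies
  \<open>J' = r\<^sup>N\<^sup>-\<^sup>1 w (N - \<alpha> - \<bar>w\<bar>\<^sup>q\<^sup>-\<^sup>1)\<close>, so once \<open>J > 0\<close> and \<open>w\<^sup>q\<^sup>-\<^sup>1 < N - \<alpha>\<close> at a radius up to which \<open>w\<close>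
  is positive, \<open>w\<close> stays positive: at a first zero \<open>J = r\<^sup>N\<^sup>-\<^sup>1 F < 0\<close>.  The set of data \<open>a > 0\<close> for which this
  happens is open and contains all small \<open>a\<close>.  The set of \<open>a > 0\<close> for which \<open>w\<close> takes negative values is open as
  well, and nonempty: rescaling large data perturbs the subcritical Emden--Fowler equation, where Pohozaev's
  identity is incompatible with the decay of a positive solution.

  The half-line is connected, so some \<open>a\<close> lies in neither set.  Its solution is positive, tends to \<open>0\<close>, and has \<open>J \<le> 0\<close>
  eventually; being increasing, \<open>J\<close> converges.  Hence \<open>r\<^sup>N w \<rightarrow> 0\<close> and \<open>r\<^sup>N\<^sup>-\<^sup>1 \<bar>F\<bar>\<close> converges.  Its limit is not zero, because
  its logarithmic derivative is at least \<open>-r \<bar>w'\<bar>\<^sup>2\<^sup>-\<^sup>p\<close>, which is integrable at infinity because \<open>\<delta> < N\<close>.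
  Integrating \<open>w'\<close> gives \<open>w \<sim> c r\<^sup>-\<^sup>\<eta>\<close>.
\<close>

section \<open>Odd powers and elementary comparison lemmas\<close>

lemma abs_signed_pow: "\<bar>signed_pow m x\<bar> = \<bar>x\<bar> powr m"
  by (cases "x = 0") (auto simp: signed_pow_def abs_mult powr_mult_base[of "\<bar>x\<bar>" "m-1", simplified, symmetric] mult.commute)

lemma signed_pow_nonneg: "x \<ge> 0 \<Longrightarrow> signed_pow m x = x powr m"
  using abs_signed_pow[of m x] by (simp add: signed_pow_def abs_mult)

lemma signed_pow_minus: "signed_pow m (- x) = - signed_pow m x"
  by (simp add: signed_pow_def)

lemma signed_pow_nonpos: "x \<le> 0 \<Longrightarrow> signed_pow m x = - (\<bar>x\<bar> powr m)"
  using signed_pow_nonneg[of "-x" m] by (simp add: signed_pow_minus)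

lemma signed_pow_mult_self: "x * signed_pow m x = \<bar>x\<bar> powr (m + 1)"
  using powr_mult_base[of "\<bar>x\<bar>" m] abs_signed_pow[of m x]
  by (cases "x \<ge> 0") (auto simp: signed_pow_nonneg signed_pow_nonpos add.commute)

lemma signed_pow_signed_pow:
  assumes "m \<noteq> 0" shows "signed_pow (1 / m) (signed_pow m x) = x"
proof (cases "x \<ge> 0")
  case True with assms show ?thesis by (simp add: signed_pow_nonneg powr_powr)
next
  case False with assms show ?thesis by (simp add: signed_pow_nonpos powr_powr)
qed

lemma signed_pow_scale: "c \<ge> 0 \<Longrightarrow> signed_pow m (c * x) = c powr m * signed_pow m x"
  using powr_mult[of c "\<bar>x\<bar>" m]
  by (cases "x \<ge> 0") (auto simp: signed_pow_nonneg signed_pow_nonpos abs_mult mult_nonneg_nonpos)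

text \<open>Away from \<open>0\<close> the power rule and oddness suffice. At \<open>0\<close> the
  difference quotient is \<open>\<bar>h\<bar> powr (m - 1)\<close>, which tends to \<open>0\<close>
  since \<open>m > 1\<close>.\<close>

lemma signed_pow_has_derivative:
  assumes "m > 1"
  shows "(signed_pow m has_real_derivative m * \<bar>x\<bar> powr (m - 1)) (at x)"
proof -
  have pos: "(signed_pow m has_real_derivative m * x powr (m - 1)) (at x)" if "x > 0" for x
  proof (rule has_field_derivative_transform_within_open[where S = "{0<..}"])
    show "((\<lambda>x. x powr m) has_real_derivative m * x powr (m - 1)) (at x)"
      using that by (auto intro!: has_real_derivative_powr)
  qed (use that in \<open>auto simp: signed_pow_nonneg\<close>)
  consider "x > 0" | "x < 0" | "x = 0" by linarith
  then show ?thesis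
  proof cases
    case 1 with pos show ?thesis by simp
  next
    case 2
    have "((\<lambda>x. - signed_pow m (- x)) has_real_derivative - (m * (-x) powr (m - 1) * -1)) (at x)"
      by (rule DERIV_minus DERIV_chain2[where g = uminus] pos)+ (use 2 in \<open>auto intro!: derivative_eq_intros\<close>)
    moreover have "(\<lambda>x. - signed_pow m (- x)) = signed_pow m" by (auto simp: signed_pow_minus)
    ultimately show ?thesis using 2 by simp
  next
    case 3
    have "((\<lambda>h. \<bar>h\<bar> powr (m - 1)) \<longlongrightarrow> \<bar>0\<bar> powr (m - 1)) (at (0::real))"
      by (rule tendsto_powr2 tendsto_intros)+ (use assms in auto)
    then have "((\<lambda>h. \<bar>h\<bar> powr (m - 1)) \<longlongrightarrow> 0) (at (0::real))"
      by simp
    then have "((\<lambda>h. (signed_pow m (0 + h) - signed_pow m 0) / h) \<longlongrightarrow> 0) (at 0)"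
      by (rule Lim_transform_eventually) (auto simp: eventually_at_filter signed_pow_def)
    then show ?thesis using 3 by (simp add: DERIV_def)
  qed
qed

text \<open>Every \<open>m > 0\<close> is admissible, even at \<open>0\<close>, where the difference
  quotient is \<open>signed_pow m h / (m + 1)\<close>. With exponents \<open>k\<close> and
  \<open>q\<close> this differentiates the energy and the Pohozaev function.\<close>

lemma abs_powr_has_derivative:
  assumes "m > 0"
  shows "((\<lambda>x. \<bar>x\<bar> powr (m + 1) / (m + 1)) has_real_derivative signed_pow m x) (at x)"
proof -
  have pos: "((\<lambda>x. \<bar>x\<bar> powr (m + 1) / (m + 1)) has_real_derivative x powr m) (at x)" if "x > 0" for x
  proof (rule has_field_derivative_transform_within_open[where S = "{0<..}"])
    show "((\<lambda>x. x powr (m + 1) / (m + 1)) has_real_derivative x powr m) (at x)"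
      using that assms by (auto intro!: derivative_eq_intros)
  qed (use that in auto)
  consider "x > 0" | "x < 0" | "x = 0" by linarith
  then show ?thesis
  proof cases
    case 1 with pos show ?thesis by (simp add: signed_pow_nonneg)
  next
    case 2
    have "((\<lambda>x. \<bar>- x\<bar> powr (m + 1) / (m + 1)) has_real_derivative ((-x) powr m * -1)) (at x)"
      by (rule DERIV_chain2[where g = uminus] pos)+ (use 2 in \<open>auto intro!: derivative_eq_intros\<close>)
    then show ?thesis using 2 by (simp add: signed_pow_nonpos)
  next
    case 3
    have "((\<lambda>h. signed_pow m h / (m + 1)) \<longlongrightarrow> 0) (at (0::real))"
    proof (rule tendsto_rabs_zero_cancel)
      have "((\<lambda>h. \<bar>h\<bar> powr m / (m+1)) \<longlongrightarrow> \<bar>0\<bar> powr m / (m+1)) (at (0::real))"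
        by (rule tendsto_powr2 tendsto_intros)+ (use assms in auto)
      then show "((\<lambda>h. \<bar>signed_pow m h / (m + 1)\<bar>) \<longlongrightarrow> 0) (at (0::real))"
        using assms by (simp add: abs_signed_pow)
    qed
    then have "((\<lambda>h. (\<bar>0+h\<bar> powr (m + 1) / (m + 1) - \<bar>0\<bar> powr (m + 1) / (m + 1)) / h) \<longlongrightarrow> 0) (at (0::real))"
      by (rule Lim_transform_eventually)
         (auto simp: eventually_at_filter signed_pow_mult_self[symmetric])
    then show ?thesis using 3 assms by (simp add: DERIV_def signed_pow_def)
  qed
qed

lemma continuous_on_abs_powr: "continuous_on S f \<Longrightarrow> m > 0 \<Longrightarrow> continuous_on S (\<lambda>x. \<bar>f x :: real\<bar> powr m)"
  by (intro continuous_intros continuous_on_powr') auto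

text \<open>For \<open>p < 2\<close> the exponent \<open>1 / (p - 1)\<close> exceeds
  \<open>1\<close>, so recovering \<open>w'\<close> from the flux is locally Lipschitz. Together
  with the case \<open>m = q\<close> this makes Gronwall's inequality applicable.\<close>

lemma signed_pow_lipschitz:
  assumes "m > 1" "\<bar>x\<bar> \<le> B" "\<bar>y\<bar> \<le> B"
  shows "\<bar>signed_pow m x - signed_pow m y\<bar> \<le> m * B powr (m - 1) * \<bar>x - y\<bar>"
proof -
  have "norm (signed_pow m x - signed_pow m y) \<le> m * B powr (m - 1) * norm (x - y)"
  proof (rule field_differentiable_bound[where S = "{-B..B}"])
    show "(signed_pow m has_field_derivative m * \<bar>z\<bar> powr (m - 1)) (at z within {-B..B})" for z
      by (rule has_field_derivative_at_within[OF signed_pow_has_derivative[OF assms(1)]])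
    show "norm (m * \<bar>z\<bar> powr (m - 1)) \<le> m * B powr (m - 1)" if "z \<in> {-B..B}" for z
      using that assms(1) by (auto simp: abs_mult intro!: powr_mono2)
  qed (use assms in auto)
  then show ?thesis by simp
qed

text \<open>Replaces integration of a differential inequality: \<open>h\<close> is an explicit
  antiderivative of the lower bound, and \<open>f - h\<close> is nondecreasing.\<close>

lemma deriv_ge_imp_increment_ge:
  fixes f h :: "real \<Rightarrow> real"
  assumes "a \<le> b" "continuous_on {a..b} f" "continuous_on {a..b} h"
    and "\<And>x. a < x \<Longrightarrow> x < b \<Longrightarrow> (f has_real_derivative f' x) (at x)"
    and "\<And>x. a < x \<Longrightarrow> x < b \<Longrightarrow> (h has_real_derivative h' x) (at x)"
    and "\<And>x. a < x \<Longrightarrow> x < b \<Longrightarrow> h' x \<le> f' x"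
  shows "h b - h a \<le> f b - f a"
proof -
  have "f a - h a \<le> f b - h b"
  proof (rule DERIV_nonneg_imp_increasing_open[OF assms(1)])
    show "\<exists>y. ((\<lambda>x. f x - h x) has_real_derivative y) (at x) \<and> 0 \<le> y" if "a < x" "x < b" for x
      using assms(4-6)[OF that] by (intro exI[of _ "f' x - h' x"]) (auto intro: DERIV_diff)
  qed (intro continuous_intros assms)
  then show ?thesis by simp
qed

text \<open>The product of \<open>\<rho>\<close> with \<open>exp (- L * x)\<close> is nonincreasing.
  Neither \<open>L\<close> nor \<open>\<rho>\<close> has a prescribed sign, so the bound can also be
  applied to a nonpositive flux.\<close>

lemma gronwall_le:
  fixes \<rho> :: "real \<Rightarrow> real"
  assumes "a \<le> b" "continuous_on {a..b} \<rho>"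
    and "\<And>x. a < x \<Longrightarrow> x < b \<Longrightarrow> (\<rho> has_real_derivative \<rho>' x) (at x)"
    and "\<And>x. a < x \<Longrightarrow> x < b \<Longrightarrow> \<rho>' x \<le> L * \<rho> x"
  shows "\<rho> b \<le> \<rho> a * exp (L * (b - a))"
proof -
  have "\<rho> b * exp (- L * b) \<le> \<rho> a * exp (- L * a)"
  proof (rule DERIV_nonpos_imp_decreasing_open[OF assms(1)])
    show "\<exists>y. ((\<lambda>x. \<rho> x * exp (- L * x)) has_real_derivative y) (at x) \<and> y \<le> 0"
      if "a < x" "x < b" for x
    proof (intro exI conjI)
      show "((\<lambda>x. \<rho> x * exp (- L * x)) has_real_derivative exp (- L * x) * (\<rho>' x - L * \<rho> x)) (at x)"
        by (auto intro!: derivative_eq_intros assms(3)[OF that] simp: algebra_simps)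
      show "exp (- L * x) * (\<rho>' x - L * \<rho> x) \<le> 0"
        using assms(4)[OF that] by (auto intro: mult_nonneg_nonpos)
    qed
  qed (intro continuous_intros assms)
  then have "\<rho> b * exp (- L * b) * exp (L * b) \<le> \<rho> a * exp (- L * a) * exp (L * b)"
    by (intro mult_right_mono) auto
  then show ?thesis by (simp add: mult.assoc exp_add[symmetric] algebra_simps)
qed

text \<open>The factor \<open>n / r\<close> avoids the truncated exponent \<open>n - 1\<close> and
  has the shape of the friction coefficient \<open>(N - 1) / r\<close>, against which it
  cancels.\<close>

lemma power_has_derivative_scaled:
  "r > 0 \<Longrightarrow> ((\<lambda>r. r ^ n) has_real_derivative (real n / r * r ^ n)) (at (r::real))"
  using DERIV_pow[of n r] by (cases n) auto

subsection \<open>The first-order system\<close>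

text \<open>The assumption \<open>subcritical\<close> is \<open>q < q_star N p\<close> with the
  denominator \<open>N - p\<close> cleared, after adding \<open>1\<close> to both sides.\<close>

locale emden_fowler =
  fixes N :: nat and p q \<alpha> :: real
  assumes p_gt_1: "1 < p" and p_lt_2: "p < 2"
    and alpha_gt: "p / (2 - p) < \<alpha>" and alpha_lt: "\<alpha> < real N"
    and q_gt_1: "1 < q" and subcritical: "(real N - p) * (q + 1) < real N * p"
begin

text \<open>The number \<open>k + 1 = p / (p - 1)\<close> is the exponent conjugate to
  \<open>p\<close>, so \<open>\<bar>F\<bar> powr (k + 1)\<close> is the \<open>p\<close>-th power of
  \<open>\<bar>w'\<bar>\<close>.\<close>

definition k :: real where "k = 1 / (p - 1)"

text \<open>
  Here \<open>F\<close> is the flux, and \<open>w'\<close> is recovered from it by the power \<open>k\<close>.  The equation of the theorem is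
  \<open>\<epsilon> = 1\<close>; the value \<open>\<epsilon> = a\<^sup>1\<^sup>-\<^sup>q\<close> arises when the solution is rescaled to have initial value \<open>1\<close>.
\<close>

definition solves :: "real \<Rightarrow> (real \<Rightarrow> real) \<Rightarrow> (real \<Rightarrow> real) \<Rightarrow> bool" where
  "solves \<epsilon> u F \<longleftrightarrow>
     (\<forall>r\<ge>0. (u has_real_derivative signed_pow k (F r)) (at r within {0..})) \<and>
     continuous_on {0..} F \<and> F 0 = 0 \<and>
     (\<forall>r>0. (F has_real_derivative
        - ((real N - 1) / r * F r) - \<epsilon> * (r * signed_pow k (F r) + \<alpha> * u r) - signed_pow q (u r)) (at r))"

text \<open>Kinetic plus potential energy of the equation; a Lyapunov function.\<close>

definition energy :: "real \<Rightarrow> (real \<Rightarrow> real) \<Rightarrow> (real \<Rightarrow> real) \<Rightarrow> real \<Rightarrow> real" where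
  "energy \<epsilon> u F r =
     \<bar>F r\<bar> powr (k + 1) / (k + 1) + \<epsilon> * \<alpha> * (u r)\<^sup>2 / 2 + \<bar>u r\<bar> powr (q + 1) / (q + 1)"

text \<open>For \<open>\<epsilon> = 1\<close> this is the quantity \<open>J\<close> of the
  outline.\<close>

definition mass :: "real \<Rightarrow> (real \<Rightarrow> real) \<Rightarrow> (real \<Rightarrow> real) \<Rightarrow> real \<Rightarrow> real" where
  "mass \<epsilon> u F r = r ^ (N - 1) * (F r + \<epsilon> * r * u r)"

lemma k_gt_1: "k > 1"
  using p_gt_1 p_lt_2 by (simp add: k_def)

lemma alpha_gt_1: "\<alpha> > 1"
proof -
  have "1 < p / (2 - p)" using p_gt_1 p_lt_2 by simp
  with alpha_gt show ?thesis by linarith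
qed

text \<open>This is \<open>\<delta> < N\<close> without denominators. It gives the integrability at
  infinity used in \<open>fast_decay\<close>.\<close>

lemma p_lt_N_frac: "p * (real N + 1) < 2 * real N"
proof -
  have "p / (2 - p) < real N" using alpha_gt alpha_lt by linarith
  then show ?thesis using p_lt_2 by (simp add: field_simps)
qed

lemma N_ge_2: "N \<ge> 2"
  using alpha_gt_1 alpha_lt by linarith

lemma N_eq_Suc: "N = Suc (N - 1)" "real (N - 1) = real N - 1"
  using N_ge_2 by auto

lemma power_N: "r ^ N = r * (r::real) ^ (N - 1)"
  by (subst N_eq_Suc(1)) simp

lemma power_N_1_deriv:
  "r > 0 \<Longrightarrow> ((\<lambda>r. r ^ (N - 1)) has_real_derivative ((real N - 1) / r * r ^ (N - 1))) (at r)"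
  using power_has_derivative_scaled[of r "N - 1"] N_eq_Suc(2) by simp

lemma power_N_div_deriv:
  "((\<lambda>r. r ^ N / real N) has_real_derivative r ^ (N - 1)) (at r)"
  using DERIV_cdivide[OF DERIV_pow[of N r], of "real N"] N_ge_2 by simp

section \<open>A priori estimates for one solution\<close>

context
  fixes \<epsilon> u F
  assumes sol: "solves \<epsilon> u F"
begin

lemma deriv_u_within: "r \<ge> 0 \<Longrightarrow> (u has_real_derivative signed_pow k (F r)) (at r within {0..})"
  using sol by (simp add: solves_def)

lemma deriv_u: "r > 0 \<Longrightarrow> (u has_real_derivative signed_pow k (F r)) (at r)"
  using deriv_u_within[of r] at_within_interior[of r "{0..}"] by simp

lemma deriv_F: "r > 0 \<Longrightarrow> (F has_real_derivative
        - ((real N - 1) / r * F r) - \<epsilon> * (r * signed_pow k (F r) + \<alpha> * u r) - signed_pow q (u r)) (at r)"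
  using sol by (simp add: solves_def)

lemma F_0 [simp]: "F 0 = 0"
  using sol by (simp add: solves_def)

lemma cont_u: "continuous_on {0..} u"
  by (auto simp: continuous_on_eq_continuous_within intro!: DERIV_continuous deriv_u_within)

lemma cont_F: "continuous_on {0..} F"
  using sol by (simp add: solves_def)

lemma cont_u_Icc: "a \<ge> 0 \<Longrightarrow> continuous_on {a..b} u"
  by (rule continuous_on_subset[OF cont_u]) auto

lemma cont_F_Icc: "a \<ge> 0 \<Longrightarrow> continuous_on {a..b} F"
  by (rule continuous_on_subset[OF cont_F]) auto

text \<open>Multiplying the equation by \<open>u'\<close> cancels the potential terms. What remains
  are the friction \<open>(N - 1) / r * F\<close> and the drift \<open>\<epsilon> * r * u'\<close>,
  both dissipative.\<close>

lemma energy_le: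
  assumes "\<epsilon> \<ge> 0" "r \<ge> 0"
  shows "energy \<epsilon> u F r \<le> energy \<epsilon> u F 0"
proof (rule DERIV_nonpos_imp_decreasing_open[OF assms(2)])
  fix x :: real assume x: "0 < x" "x < r"
  let ?v = "signed_pow k (F x)"
  have "(energy \<epsilon> u F has_real_derivative - ((real N - 1) / x * (F x * ?v)) - \<epsilon> * x * ?v\<^sup>2) (at x)"
  proof -
    have 1: "((\<lambda>r. \<bar>F r\<bar> powr (k + 1) / (k + 1)) has_real_derivative
        ?v * (- ((real N - 1) / x * F x) - \<epsilon> * (x * ?v + \<alpha> * u x) - signed_pow q (u x))) (at x)"
      using x k_gt_1 by (intro DERIV_chain2[OF abs_powr_has_derivative] deriv_F) auto
    have 2: "((\<lambda>r. \<bar>u r\<bar> powr (q + 1) / (q + 1)) has_real_derivative signed_pow q (u x) * ?v) (at x)"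
      using x q_gt_1 by (intro DERIV_chain2[OF abs_powr_has_derivative] deriv_u) auto
    have 3: "((\<lambda>r. \<epsilon> * \<alpha> * (u r)\<^sup>2 / 2) has_real_derivative \<epsilon> * \<alpha> * u x * ?v) (at x)"
      using x by (auto intro!: derivative_eq_intros deriv_u)
    show ?thesis
      unfolding energy_def [abs_def]
      by (rule DERIV_cong[OF DERIV_add[OF DERIV_add[OF 1 3] 2]]) (simp add: algebra_simps power2_eq_square)
  qed
  moreover have "(real N - 1) / x * (F x * ?v) \<ge> 0"
    using x N_ge_2 by (simp add: signed_pow_mult_self)
  moreover have "\<epsilon> * x * ?v\<^sup>2 \<ge> 0" using x assms by simp
  ultimately show "\<exists>y. (energy \<epsilon> u F has_real_derivative y) (at x) \<and> y \<le> 0"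
    by (intro exI conjI) (assumption, linarith)
next
  show "continuous_on {0..r} (energy \<epsilon> u F)"
    unfolding energy_def [abs_def]
    by (intro continuous_intros continuous_on_abs_powr cont_u_Icc cont_F_Icc) (use k_gt_1 q_gt_1 in auto)
qed

text \<open>The energy bounds \<open>\<bar>F\<bar> powr (k + 1)\<close>. Because
  \<open>B \<ge> 1\<close>, a violation would have \<open>\<bar>F\<bar> > 1\<close>, where
  \<open>\<bar>F\<bar>\<close> is at most that power; so no root has to be taken.\<close>

lemma F_bound:
  assumes "\<epsilon> \<ge> 0" "r \<ge> 0" "(k + 1) * energy \<epsilon> u F 0 \<le> B" "B \<ge> 1"
  shows "\<bar>F r\<bar> \<le> B"
proof (rule ccontr)
  assume "\<not> \<bar>F r\<bar> \<le> B"
  then have *: "B < \<bar>F r\<bar>" "1 < \<bar>F r\<bar>" using assms by auto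
  have "\<bar>F r\<bar> powr 1 \<le> \<bar>F r\<bar> powr (k + 1)"
    using * k_gt_1 by (intro powr_mono) auto
  moreover have "\<bar>F r\<bar> powr (k + 1) / (k + 1) \<le> energy \<epsilon> u F r"
    using assms q_gt_1 alpha_gt_1 by (auto simp: energy_def)
  then have "\<bar>F r\<bar> powr (k + 1) \<le> (k + 1) * energy \<epsilon> u F 0"
    using energy_le[OF assms(1,2)] k_gt_1 by (simp add: field_simps) (smt (verit) mult_left_mono)
  ultimately show False using * assms by simp
qed

text \<open>First \<open>F \<le> 0\<close>, since all terms of \<open>F'\<close> are nonpositive
  where \<open>F > 0\<close>. If \<open>F\<close> vanished at \<open>R\<close>, a backward Gronwall
  estimate would give \<open>F = 0\<close> on all of \<open>[0, R]\<close>, so \<open>u\<close>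
  would be a positive constant, contradicting the equation.\<close>

lemma F_neg:
  assumes "\<epsilon> \<ge> 0" "u 0 > 0" "\<And>s. 0 \<le> s \<Longrightarrow> s \<le> R \<Longrightarrow> u s \<ge> 0" "0 < R"
  shows "F R < 0"
proof -
  have Fle: "F r \<le> 0" if "0 \<le> r" "r \<le> R" for r
  proof (rule ccontr)
    assume "\<not> F r \<le> 0"
    then have Fr: "F r > 0" by simp
    \<comment> \<open>The last point of \<open>[0, r]\<close> with \<open>F \<le> 0\<close>; beyond
      it \<open>F\<close> is positive and hence cannot increase.\<close>
    define r0 where "r0 = Sup {s \<in> {0..r}. F s \<le> 0}"
    have cl: "compact {s \<in> {0..r}. F s \<le> 0}"
    proof -
      have "closed {s \<in> {0..r}. F s \<le> 0}"
        by (intro continuous_on_closed_Collect_le cont_F_Icc continuous_intros) auto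
      moreover have "bounded {s \<in> {0..r}. F s \<le> 0}"
        by (rule bounded_subset[OF bounded_closed_interval[of 0 r]]) auto
      ultimately show ?thesis by (simp add: compact_eq_bounded_closed)
    qed
    have ne: "0 \<in> {s \<in> {0..r}. F s \<le> 0}" using that by simp
    have r0: "r0 \<in> {s \<in> {0..r}. F s \<le> 0}"
      unfolding r0_def using cl ne by (intro closed_contains_Sup compact_imp_closed) (auto intro!: bdd_aboveI[of _ r])
    have pos: "F s > 0" if "r0 < s" "s \<le> r" for s
    proof (rule ccontr)
      assume "\<not> F s > 0"
      then have "s \<in> {s \<in> {0..r}. F s \<le> 0}" using that r0 by auto
      then have "s \<le> r0" unfolding r0_def by (intro cSup_upper) (auto intro!: bdd_aboveI[of _ r])
      with that show False by simp
    qed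
    have "r0 < r" using r0 Fr by (cases "r0 = r") auto
    have "F r \<le> F r0"
    proof (rule DERIV_nonpos_imp_decreasing_open[where f = F and a = r0 and b = r])
      fix x assume x: "r0 < x" "x < r"
      then have "x > 0" using r0 by auto
      have "F x > 0" "u x \<ge> 0" using pos[of x] assms(3)[of x] x \<open>x > 0\<close> \<open>r \<le> R\<close> by auto
      then have "0 \<le> (real N - 1) / x * F x" "0 \<le> \<epsilon> * (x * signed_pow k (F x) + \<alpha> * u x)" "0 \<le> signed_pow q (u x)"
        using \<open>x > 0\<close> N_ge_2 assms(1) alpha_gt_1 by (auto simp: signed_pow_nonneg)
      then show "\<exists>y. (F has_real_derivative y) (at x) \<and> y \<le> 0"
        using deriv_F[OF \<open>x > 0\<close>] by (intro exI conjI) (assumption, linarith)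
    qed (use \<open>r0 < r\<close> r0 in \<open>auto intro!: cont_F_Icc\<close>)
    then show False using Fr r0 by auto
  qed
  obtain M where M: "\<And>s. s \<in> {0..R} \<Longrightarrow> \<bar>F s\<bar> \<le> M"
  proof -
    have "bounded (F ` {0..R})" by (intro compact_imp_bounded compact_continuous_image cont_F_Icc) auto
    then show thesis using that unfolding bounded_iff by (metis imageI real_norm_def)
  qed
  show "F R < 0"
  proof (rule ccontr)
    assume "\<not> F R < 0"
    then have FR: "F R = 0" using Fle[of R] assms by auto
    have F0: "F s = 0" if s: "0 < s" "s \<le> R" for s
    proof -
      \<comment> \<open>On \<open>[s, R]\<close> this rate gives \<open>F' \<le> - L * F\<close>;
        starting at \<open>s > 0\<close> keeps the friction coefficient bounded. Then
        \<open>F R = 0\<close> forces \<open>F s \<ge> 0\<close>.\<close>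
      define L where "L = (real N - 1) / s + \<epsilon> * R * M powr (k - 1)"
      have "F R \<le> F s * exp (- L * (R - s))"
      proof (rule gronwall_le[where \<rho>' = "\<lambda>r. - ((real N - 1) / r * F r) - \<epsilon> * (r * signed_pow k (F r) + \<alpha> * u r) - signed_pow q (u r)"])
        fix x assume x: "s < x" "x < R"
        then have x0: "x > 0" using s by simp
        show "(F has_real_derivative - ((real N - 1) / x * F x) - \<epsilon> * (x * signed_pow k (F x) + \<alpha> * u x) - signed_pow q (u x)) (at x)"
          by (rule deriv_F[OF x0])
        have "F x \<le> 0" "u x \<ge> 0" "\<bar>F x\<bar> \<le> M" using Fle[of x] assms(3)[of x] M[of x] x x0 by auto
        then have "(real N - 1) / x * \<bar>F x\<bar> \<le> (real N - 1) / s * \<bar>F x\<bar>"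
          using x s N_ge_2 by (intro mult_right_mono divide_left_mono) auto
        moreover have "\<epsilon> * x * (\<bar>F x\<bar> powr (k - 1) * \<bar>F x\<bar>) \<le> \<epsilon> * R * (M powr (k - 1) * \<bar>F x\<bar>)"
          using x x0 k_gt_1 assms(1) \<open>\<bar>F x\<bar> \<le> M\<close> by (intro mult_mono powr_mono2) auto
        moreover have "0 \<le> \<epsilon> * \<alpha> * u x + signed_pow q (u x)" 
          using assms(1) alpha_gt_1 \<open>u x \<ge> 0\<close> by (simp add: signed_pow_nonneg)
        ultimately show "- ((real N - 1) / x * F x) - \<epsilon> * (x * signed_pow k (F x) + \<alpha> * u x) - signed_pow q (u x) \<le> - L * F x"
          using \<open>F x \<le> 0\<close> unfolding L_def signed_pow_def[of k]
          by (simp add: algebra_simps add_divide_distrib diff_divide_distrib)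
      qed (use s in \<open>auto intro!: cont_F_Icc\<close>)
      then have "F s \<ge> 0" using FR by (simp add: zero_le_mult_iff)
      with Fle[of s] s show ?thesis by auto
    qed
    have u_const: "u s = u 0" if "0 < s" "s \<le> R" for s
    proof -
      have "((\<lambda>r. u r) has_real_derivative 0) (at r within {0..R})" if "r \<in> {0..R}" for r
      proof -
        have "F r = 0" using that F0[of r] by (cases "r = 0") auto
        then show ?thesis
          using has_field_derivative_subset[OF deriv_u_within[of r], of "{0..R}"] that
          by (simp add: signed_pow_def)
      qed
      then have "\<exists>c. \<forall>x\<in>{0..R}. u x = c"
        by (intro has_field_derivative_zero_constant) auto
      then show ?thesis using that assms by force
    qed
    \<comment> \<open>At an interior point, vanishing flux and constant \<open>u\<close> reduce the
      equation to \<open>\<epsilon> * \<alpha> * u 0 + signed_pow q (u 0) = 0\<close>.\<close>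
    have "((\<lambda>_. 0) has_real_derivative - ((real N - 1) / (R/2) * F (R/2)) - \<epsilon> * ((R/2) * signed_pow k (F (R/2)) + \<alpha> * u (R/2)) - signed_pow q (u (R/2))) (at (R/2))"
      by (rule has_field_derivative_transform_within_open[OF deriv_F, of _ "{0<..<R}"]) (use assms F0 in auto)
    then have "- ((real N - 1) / (R/2) * F (R/2)) - \<epsilon> * ((R/2) * signed_pow k (F (R/2)) + \<alpha> * u (R/2)) - signed_pow q (u (R/2)) = 0"
      by (rule DERIV_unique) simp
    then have "\<epsilon> * \<alpha> * u 0 + signed_pow q (u 0) = 0"
      using F0[of "R/2"] u_const[of "R/2"] assms by (simp add: signed_pow_def)
    moreover have "signed_pow q (u 0) > 0" using assms by (simp add: signed_pow_nonneg)
    moreover have "\<epsilon> * \<alpha> * u 0 \<ge> 0" using assms alpha_gt_1 by simp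
    ultimately show False by simp
  qed
qed

lemma u_strict_antimono:
  assumes "\<epsilon> \<ge> 0" "u 0 > 0" "\<And>s. 0 \<le> s \<Longrightarrow> s \<le> R \<Longrightarrow> u s \<ge> 0" "0 \<le> x" "x < y" "y \<le> R"
  shows "u y < u x"
proof (rule DERIV_neg_imp_decreasing_open[OF \<open>x < y\<close>])
  fix z assume z: "x < z" "z < y"
  then have "F z < 0" by (intro F_neg assms) (use assms in auto)
  then show "\<exists>d. (u has_real_derivative d) (at z) \<and> d < 0"
    using deriv_u[of z] z assms by (intro exI[of _ "signed_pow k (F z)"]) (auto simp: signed_pow_nonpos)
qed (use assms in \<open>auto intro!: cont_u_Icc\<close>)

lemma u_antimono:
  assumes "\<epsilon> \<ge> 0" "u 0 > 0" "\<And>s. 0 \<le> s \<Longrightarrow> s \<le> R \<Longrightarrow> u s \<ge> 0" "0 \<le> x" "x \<le> y" "y \<le> R"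
  shows "u y \<le> u x"
  using u_strict_antimono[OF assms(1-4) _ assms(6)] assms(5) by (cases "x = y") auto

lemma mass_0: "mass \<epsilon> u F 0 = 0"
  by (simp add: mass_def)

lemma cont_mass: "a \<ge> 0 \<Longrightarrow> continuous_on {a..b} (mass \<epsilon> u F)"
  unfolding mass_def [abs_def] by (intro continuous_intros cont_u_Icc cont_F_Icc)

text \<open>The weight \<open>r ^ (N - 1)\<close> absorbs the friction, and the derivative of
  \<open>\<epsilon> * r * u\<close> cancels the drift, so no derivative of \<open>u\<close>
  survives.\<close>

lemma deriv_mass:
  assumes "r > 0"
  shows "(mass \<epsilon> u F has_real_derivative r ^ (N - 1) * (\<epsilon> * (real N - \<alpha>) * u r - signed_pow q (u r))) (at r)"
  unfolding mass_def [abs_def]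
  by (rule DERIV_cong[OF DERIV_mult[OF power_N_1_deriv[OF assms] DERIV_add[OF deriv_F[OF assms]
        DERIV_mult[OF DERIV_cmult_Id[of \<epsilon>] deriv_u[OF assms]]]]])
     (use assms in \<open>simp add: field_simps\<close>)

end
end

subsection \<open>Positivity and continuous dependence\<close>

lemma first_zero:
  fixes u :: "real \<Rightarrow> real"
  assumes "continuous_on {0..r} u" "u 0 > 0" "u r \<le> 0" "r \<ge> 0"
  obtains z where "0 < z" "z \<le> r" "u z = 0" "\<And>s. 0 \<le> s \<Longrightarrow> s < z \<Longrightarrow> u s > 0"
proof -
  have ivt: "\<exists>x. 0 \<le> x \<and> x \<le> s \<and> u x = 0" if "0 \<le> s" "s \<le> r" "u s \<le> 0" for s
    using IVT2'[of u s 0 0] that assms continuous_on_subset[OF assms(1), of "{0..s}"] by auto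
  define Z where "Z = {s \<in> {0..r}. u s = 0}"
  have "closed Z" unfolding Z_def
    by (intro continuous_closed_preimage_constant assms) auto
  moreover have "Z \<noteq> {}" using ivt[of r] assms by (auto simp: Z_def)
  moreover have bdd: "bdd_below Z" by (auto simp: Z_def intro!: bdd_belowI[of _ 0])
  ultimately have z: "Inf Z \<in> Z" by (intro closed_contains_Inf)
  have "u s > 0" if s: "0 \<le> s" "s < Inf Z" for s
  proof (rule ccontr)
    assume "\<not> u s > 0"
    moreover have "s \<le> r" using s z by (auto simp: Z_def)
    ultimately obtain x where "0 \<le> x" "x \<le> s" "u x = 0" using ivt[of s] s by auto
    then have "x \<in> Z" using \<open>s \<le> r\<close> by (auto simp: Z_def)
    then have "Inf Z \<le> x" by (intro cInf_lower bdd)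
    with s \<open>x \<le> s\<close> show False by simp
  qed
  moreover have "Inf Z \<noteq> 0" using z assms(2) by (auto simp: Z_def)
  ultimately show thesis using that[of "Inf Z"] z by (auto simp: Z_def)
qed

context emden_fowler
begin

text \<open>Strict decrease: a zero at \<open>r\<close> would make \<open>u (r + 1)\<close>
  negative.\<close>

lemma nonneg_imp_pos:
  assumes "solves \<epsilon> u F" "\<epsilon> \<ge> 0" "u 0 > 0" "\<And>s. 0 \<le> s \<Longrightarrow> u s \<ge> 0" "r \<ge> 0"
  shows "u r > 0"
proof -
  have "u (r + 1) < u r"
    by (rule u_strict_antimono[OF assms(1-3), of "r + 1"]) (use assms in auto)
  then show ?thesis using assms(4)[of "r + 1"] assms(5) by simp
qed

text \<open>The hypotheses concern a compact interval only, which makes them stable under small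
  changes of the data. Smallness at \<open>R\<close> persists up to a first zero because
  \<open>u\<close> decreases there, so \<open>mass\<close> stays positive, contrary to its sign at a
  zero.\<close>

lemma mass_criterion:
  assumes sol: "solves 1 u F" and "0 < R"
    and pos: "\<And>s. 0 \<le> s \<Longrightarrow> s \<le> R \<Longrightarrow> u s > 0"
    and mass: "mass 1 u F R > 0" and small: "u R powr (q - 1) < real N - \<alpha>"
    and "r \<ge> 0"
  shows "u r > 0"
proof (rule ccontr)
  assume "\<not> u r > 0"
  then obtain z where z: "0 < z" "z \<le> r" "u z = 0" "\<And>s. 0 \<le> s \<Longrightarrow> s < z \<Longrightarrow> u s > 0"
    using first_zero[of r u] cont_u_Icc[OF sol, of 0 r] pos[of 0] \<open>r \<ge> 0\<close> \<open>0 < R\<close> by auto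
  have u0: "u 0 > 0" using pos[of 0] \<open>0 < R\<close> by simp
  have nn: "u s \<ge> 0" if "0 \<le> s" "s \<le> z" for s
    using z(3) z(4)[of s] that by (cases "s = z") auto
  have "R < z" using pos[of z] z by (cases "R < z") auto
  have "mass 1 u F R \<le> mass 1 u F z"
  proof (rule DERIV_nonneg_imp_increasing_open[where f = "mass 1 u F" and a = R and b = z])
    fix s assume s: "R < s" "s < z"
    have "u s \<le> u R"
      by (rule u_antimono[OF sol, of z]) (use s u0 nn \<open>0 < R\<close> in auto)
    moreover have us: "u s > 0" using z(4)[of s] s \<open>0 < R\<close> by simp
    ultimately have "u s powr (q - 1) \<le> u R powr (q - 1)"
      using q_gt_1 by (intro powr_mono2) auto
    then have "0 \<le> s ^ (N - 1) * (1 * (real N - \<alpha>) * u s - signed_pow q (u s))"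
      using small us s \<open>0 < R\<close> by (auto simp: signed_pow_def intro!: mult_nonneg_nonneg)
    then show "\<exists>y. (mass 1 u F has_real_derivative y) (at s) \<and> 0 \<le> y"
      using deriv_mass[OF sol, of s] s \<open>0 < R\<close> by (intro exI conjI) auto
  qed (use \<open>R < z\<close> \<open>0 < R\<close> cont_mass[OF sol] in auto)
  moreover have "F z < 0"
    by (rule F_neg[OF sol]) (use nn z u0 in auto)
  then have "mass 1 u F z \<le> 0"
    using z by (auto simp: mass_def intro!: mult_nonneg_nonpos)
  ultimately show False using mass by simp
qed

text \<open>The \<open>mass\<close> starts from \<open>0\<close> and increases strictly as long as
  \<open>u\<close> is positive, since \<open>u\<close> remains below its initial value.\<close>

lemma small_data_mass_pos:
  assumes sol: "solves 1 u F" and "u 0 > 0" and small: "u 0 powr (q - 1) < real N - \<alpha>"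
  shows "\<exists>R>0. (\<forall>s. 0 \<le> s \<longrightarrow> s \<le> R \<longrightarrow> u s > 0) \<and> mass 1 u F R > 0 \<and> u R powr (q - 1) < real N - \<alpha>"
proof -
  have "(u \<longlongrightarrow> u 0) (at 0 within {0..})"
    using cont_u[OF sol] by (auto simp: continuous_on_def)
  then have "\<forall>\<^sub>F s in at 0 within {0..}. u s > 0"
    by (rule order_tendstoD) (use assms in auto)
  then obtain d where "d > 0" and d': "\<forall>s\<in>{0..}. s \<noteq> 0 \<and> dist s 0 < d \<longrightarrow> u s > 0"
    unfolding eventually_at by blast
  have d: "d > 0" "\<And>s. 0 \<le> s \<Longrightarrow> s < d \<Longrightarrow> u s > 0"
    using \<open>d > 0\<close> d'[rule_format, of s for s] \<open>u 0 > 0\<close> by (simp, metis abs_of_nonneg atLeast_iff dist_0_norm dist_commute real_norm_def)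
  define R where "R = d / 2"
  have R: "R > 0" "\<And>s. 0 \<le> s \<Longrightarrow> s \<le> R \<Longrightarrow> u s > 0" using d by (auto simp: R_def)
  have le: "u s powr (q - 1) < real N - \<alpha>" if "0 \<le> s" "s \<le> R" for s
  proof -
    have "u s \<le> u 0" by (rule u_antimono[OF sol, of R]) (use that R assms in \<open>auto intro: less_imp_le\<close>)
    then have "u s powr (q - 1) \<le> u 0 powr (q - 1)"
      using q_gt_1 R(2)[of s] that by (intro powr_mono2) auto
    then show ?thesis using small by simp
  qed
  have "mass 1 u F 0 < mass 1 u F R"
  proof (rule DERIV_pos_imp_increasing_open[OF R(1)])
    fix s assume s: "0 < s" "s < R"
    then have "0 < s ^ (N - 1) * (1 * (real N - \<alpha>) * u s - signed_pow q (u s))"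
      using le[of s] R(2)[of s] by (auto simp: signed_pow_def intro!: mult_pos_pos)
    then show "\<exists>y. (mass 1 u F has_real_derivative y) (at s) \<and> 0 < y"
      using deriv_mass[OF sol, of s] s by (intro exI conjI) auto
  qed (auto intro!: cont_mass[OF sol])
  then show ?thesis using R le[of R] by (intro exI[of _ R]) (auto simp: mass_0[OF sol])
qed

lemma uniform_bound:
  "\<exists>B. \<forall>u F r. solves 1 u F \<longrightarrow> \<bar>u 0\<bar> \<le> A \<longrightarrow> r \<ge> 0 \<longrightarrow> \<bar>u r\<bar> \<le> B \<and> \<bar>F r\<bar> \<le> B"
proof -
  define E where "E = \<alpha> * A\<^sup>2 / 2 + A powr (q + 1) / (q + 1)"
  \<comment> \<open>Including \<open>1\<close> meets the hypothesis of \<open>F_bound\<close> and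
    turns a bound of the square of \<open>u\<close> by \<open>B\<close> into one by the square of
    \<open>B\<close>.\<close>
  define B where "B = max 1 (max (2 * E / \<alpha>) ((k + 1) * E))"
  have "\<bar>u r\<bar> \<le> B \<and> \<bar>F r\<bar> \<le> B" if sol: "solves 1 u F" and A: "\<bar>u 0\<bar> \<le> A" and r: "r \<ge> 0" for u F r
  proof -
    have "\<alpha> * (u 0)\<^sup>2 / 2 \<le> \<alpha> * A\<^sup>2 / 2"
      using A alpha_gt_1 by (auto simp: abs_le_square_iff[symmetric])
    moreover have "\<bar>u 0\<bar> powr (q + 1) / (q + 1) \<le> A powr (q + 1) / (q + 1)"
      using A q_gt_1 by (intro divide_right_mono powr_mono2) auto
    ultimately have E0: "energy 1 u F 0 \<le> E"
      using k_gt_1 by (simp add: energy_def E_def F_0[OF sol])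
    have "(k + 1) * energy 1 u F 0 \<le> (k + 1) * E" using E0 k_gt_1 by simp
    then have FB: "\<bar>F r\<bar> \<le> B"
      by (intro F_bound[OF sol]) (use r in \<open>auto simp: B_def\<close>)
    have "\<alpha> * (u r)\<^sup>2 / 2 \<le> energy 1 u F r"
      using k_gt_1 q_gt_1 by (auto simp: energy_def)
    then have "\<alpha> * (u r)\<^sup>2 / 2 \<le> E" using energy_le[OF sol _ r] E0 by simp
    then have "(u r)\<^sup>2 \<le> 2 * E / \<alpha>" using alpha_gt_1 by (simp add: field_simps)
    then have "\<bar>u r\<bar> \<^sup>2 \<le> B * 1" by (auto simp: B_def)
    also have "\<dots> \<le> B * B" by (rule mult_left_mono) (auto simp: B_def)
    finally have "\<bar>u r\<bar>\<^sup>2 \<le> B\<^sup>2" unfolding power2_eq_square[of B] .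
    then have "\<bar>u r\<bar> \<le> B"
      by (rule power2_le_imp_le) (simp add: B_def)
    with FB show ?thesis by simp
  qed
  then show ?thesis by blast
qed

lemma continuous_dependence:
  assumes "R \<ge> 0"
  shows "\<exists>L>0. \<forall>u F v G. solves 1 u F \<longrightarrow> solves 1 v G \<longrightarrow> \<bar>u 0\<bar> \<le> A \<longrightarrow> \<bar>v 0\<bar> \<le> A \<longrightarrow>
     (\<forall>r\<in>{0..R}. \<bar>u r - v r\<bar> \<le> L * \<bar>u 0 - v 0\<bar> \<and> \<bar>F r - G r\<bar> \<le> L * \<bar>u 0 - v 0\<bar>)"
proof -
  obtain B where B: "\<And>u F r. solves 1 u F \<Longrightarrow> \<bar>u 0\<bar> \<le> A \<Longrightarrow> r \<ge> 0 \<Longrightarrow> \<bar>u r\<bar> \<le> B"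
    "\<And>u F r. solves 1 u F \<Longrightarrow> \<bar>u 0\<bar> \<le> A \<Longrightarrow> r \<ge> 0 \<Longrightarrow> \<bar>F r\<bar> \<le> B"
    using uniform_bound[of A] by blast
  define K1 where "K1 = k * B powr (k - 1)"
  define K2 where "K2 = q * B powr (q - 1)"
  \<comment> \<open>The first three summands come from products \<open>X * Y\<close>, split by
    \<open>2 * X * Y \<le> X\<^sup>2 + Y\<^sup>2\<close>; the last bounds the drift on
    \<open>[0, R]\<close>.\<close>
  define L where "L = K1 + \<alpha> + K2 + 2 * R * K1"
  have K: "K1 \<ge> 0" "K2 \<ge> 0" using k_gt_1 q_gt_1 by (auto simp: K1_def K2_def)
  then have L0: "L \<ge> 0" using assms alpha_gt_1 by (auto simp: L_def)
  have "\<bar>u r - v r\<bar> \<le> exp (L * R) * \<bar>u 0 - v 0\<bar> \<and> \<bar>F r - G r\<bar> \<le> exp (L * R) * \<bar>u 0 - v 0\<bar>"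
    if u: "solves 1 u F" and v: "solves 1 v G" and A: "\<bar>u 0\<bar> \<le> A" "\<bar>v 0\<bar> \<le> A" and r: "r \<in> {0..R}"
    for u F v G r
  proof -
    define \<rho> where "\<rho> = (\<lambda>r. (u r - v r)\<^sup>2 + (F r - G r)\<^sup>2)"
    define D where "D = (\<lambda>s. signed_pow k (F s) - signed_pow k (G s))"
    define E where "E = (\<lambda>s. signed_pow q (u s) - signed_pow q (v s))"
    define \<rho>' where "\<rho>' = (\<lambda>s. 2 * (u s - v s) * D s
       + 2 * (F s - G s) * (- ((real N - 1) / s * (F s - G s)) - s * D s - \<alpha> * (u s - v s) - E s))"
    have "\<rho> r \<le> \<rho> 0 * exp (L * (r - 0))"
    proof (rule gronwall_le[where \<rho>' = \<rho>'])
      show "continuous_on {0..r} \<rho>"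
        unfolding \<rho>_def by (intro continuous_intros cont_u_Icc[OF u] cont_F_Icc[OF u] cont_u_Icc[OF v] cont_F_Icc[OF v]) auto
      fix s assume s: "0 < s" "s < r"
      show "(\<rho> has_real_derivative \<rho>' s) (at s)"
        unfolding \<rho>_def \<rho>'_def
        by (rule DERIV_cong[OF DERIV_add[OF DERIV_power[OF DERIV_diff[OF deriv_u[OF u s(1)] deriv_u[OF v s(1)]]]
                DERIV_power[OF DERIV_diff[OF deriv_F[OF u s(1)] deriv_F[OF v s(1)]]]]])
           (simp add: D_def E_def algebra_simps add_divide_distrib diff_divide_distrib)
      define X Y where "X = \<bar>u s - v s\<bar>" and "Y = \<bar>F s - G s\<bar>"
      have XY: "X \<ge> 0" "Y \<ge> 0" by (auto simp: X_def Y_def)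
      have D: "\<bar>D s\<bar> \<le> K1 * Y"
        unfolding D_def K1_def Y_def using s B(2)[OF u A(1), of s] B(2)[OF v A(2), of s] k_gt_1
        by (intro signed_pow_lipschitz) auto
      have E: "\<bar>E s\<bar> \<le> K2 * X"
        unfolding E_def K2_def X_def using s B(1)[OF u A(1), of s] B(1)[OF v A(2), of s] q_gt_1
        by (intro signed_pow_lipschitz) auto
      have "\<rho> s = X\<^sup>2 + Y\<^sup>2" by (simp add: \<rho>_def X_def Y_def)
      have "(u s - v s) * D s \<le> X * (K1 * Y)"
        using mult_mono[OF order_refl[of X] D XY(1)] by (simp add: X_def abs_mult[symmetric])
      moreover have "- ((F s - G s) * (s * D s)) \<le> R * K1 * Y\<^sup>2"
      proof -
        have "- ((F s - G s) * (s * D s)) \<le> \<bar>(F s - G s) * (s * D s)\<bar>" by simp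
        also have "\<dots> = s * (Y * \<bar>D s\<bar>)" using s by (simp add: abs_mult Y_def)
        also have "\<dots> \<le> R * (Y * (K1 * Y))"
          using s r D XY by (intro mult_mono mult_left_mono) auto
        finally show ?thesis by (simp add: power2_eq_square algebra_simps)
      qed
      moreover have "- ((F s - G s) * (\<alpha> * (u s - v s))) \<le> \<alpha> * (X * Y)"
      proof -
        have "- ((F s - G s) * (\<alpha> * (u s - v s))) \<le> \<bar>(F s - G s) * (\<alpha> * (u s - v s))\<bar>" by simp
        also have "\<dots> = \<alpha> * (X * Y)" using alpha_gt_1 by (simp add: abs_mult X_def Y_def)
        finally show ?thesis .
      qed
      moreover have "- ((F s - G s) * E s) \<le> Y * (K2 * X)"
      proof -
        have "- ((F s - G s) * E s) \<le> \<bar>(F s - G s) * E s\<bar>" by simp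
        also have "\<dots> \<le> Y * (K2 * X)" unfolding abs_mult Y_def[symmetric] using E XY by (intro mult_left_mono)
        finally show ?thesis .
      qed
      moreover have "0 \<le> (real N - 1) / s * (F s - G s)\<^sup>2" using s N_ge_2 by simp
      moreover have "2 * X * Y * (K1 + \<alpha> + K2) \<le> (X\<^sup>2 + Y\<^sup>2) * (K1 + \<alpha> + K2)"
        using sum_squares_bound[of X Y] K alpha_gt_1 by (intro mult_right_mono) auto
      moreover have "0 \<le> 2 * R * K1 * X\<^sup>2" using K assms by simp
      moreover have "\<rho>' s = 2 * ((u s - v s) * D s) - 2 * ((real N - 1) / s * (F s - G s)\<^sup>2)
          - 2 * ((F s - G s) * (s * D s)) - 2 * ((F s - G s) * (\<alpha> * (u s - v s))) - 2 * ((F s - G s) * E s)"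
      proof -
        have "2 * U * V + 2 * W * (- (c * W) - a - b - e) =
            2 * (U * V) - 2 * (c * W\<^sup>2) - 2 * (W * a) - 2 * (W * b) - 2 * (W * e)" for U V W a b c e :: real
          by (simp add: algebra_simps power2_eq_square)
        then show ?thesis unfolding \<rho>'_def .
      qed
      moreover have "2 * X * Y * (K1 + \<alpha> + K2) = 2 * (X * (K1 * Y)) + 2 * (\<alpha> * (X * Y)) + 2 * (Y * (K2 * X))"
        by (simp add: algebra_simps)
      moreover have "L * (X\<^sup>2 + Y\<^sup>2) = (X\<^sup>2 + Y\<^sup>2) * (K1 + \<alpha> + K2) + 2 * R * K1 * X\<^sup>2 + 2 * (R * K1 * Y\<^sup>2)"
        by (simp add: L_def algebra_simps)
      ultimately have "\<rho>' s \<le> L * (X\<^sup>2 + Y\<^sup>2)" by linarith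
      then show "\<rho>' s \<le> L * \<rho> s" unfolding \<open>\<rho> s = X\<^sup>2 + Y\<^sup>2\<close> .
    qed (use r in auto)
    also have "\<rho> 0 = (u 0 - v 0)\<^sup>2" by (simp add: \<rho>_def F_0[OF u] F_0[OF v])
    also have "(u 0 - v 0)\<^sup>2 * exp (L * (r - 0)) \<le> (u 0 - v 0)\<^sup>2 * (exp (L * R) * exp (L * R))"
    proof (rule mult_left_mono)
      have "exp (L * (r - 0)) \<le> exp (L * R) * 1" using mult_left_mono[of r R L] r L0 by simp
      also have "\<dots> \<le> exp (L * R) * exp (L * R)" by (rule mult_left_mono) (use L0 assms in simp_all)
      finally show "exp (L * (r - 0)) \<le> exp (L * R) * exp (L * R)" .
    qed simp
    finally have le: "\<rho> r \<le> (exp (L * R) * \<bar>u 0 - v 0\<bar>)\<^sup>2"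
      by (simp add: power_mult_distrib power2_eq_square[of "exp _"] mult.commute)
    have "\<bar>u r - v r\<bar>\<^sup>2 \<le> \<rho> r" "\<bar>F r - G r\<bar>\<^sup>2 \<le> \<rho> r" by (auto simp: \<rho>_def)
    then have "\<bar>u r - v r\<bar>\<^sup>2 \<le> (exp (L * R) * \<bar>u 0 - v 0\<bar>)\<^sup>2" "\<bar>F r - G r\<bar>\<^sup>2 \<le> (exp (L * R) * \<bar>u 0 - v 0\<bar>)\<^sup>2"
      using le by linarith+
    then show ?thesis by (intro conjI) (rule power2_le_imp_le; simp)+
  qed
  then show ?thesis by (intro exI[of _ "exp (L * R)"]) auto
qed
end

subsection \<open>Fast decay\<close>

lemma mono_bounded_tendsto_at_top:
  fixes f :: "real \<Rightarrow> real"
  assumes mono: "\<And>x y. a \<le> x \<Longrightarrow> x \<le> y \<Longrightarrow> f x \<le> f y" and bdd: "\<And>x. a \<le> x \<Longrightarrow> f x \<le> b"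
  obtains L where "(f \<longlongrightarrow> L) at_top" "L \<le> b"
proof
  define L where "L = Sup (f ` {a..})"
  have bd: "bdd_above (f ` {a..})" using bdd by (auto intro!: bdd_aboveI[of _ b])
  show "L \<le> b" unfolding L_def by (rule cSup_least) (use bdd in auto)
  show "(f \<longlongrightarrow> L) at_top"
  proof (rule order_tendstoI)
    fix y assume "y < L"
    then obtain x where x: "x \<ge> a" "y < f x"
      unfolding L_def using less_cSup_iff[OF _ bd, of y] by auto
    show "\<forall>\<^sub>F z in at_top. y < f z"
      using eventually_ge_at_top[of x] by eventually_elim (use x mono[of x] in fastforce)
  next
    fix y assume "L < y"
    show "\<forall>\<^sub>F z in at_top. f z < y"
      using eventually_ge_at_top[of a]
    proof eventually_elim
      case (elim z)
      then have "f z \<le> L" unfolding L_def by (intro cSup_upper bd) auto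
      with \<open>L < y\<close> show ?case by simp
    qed
  qed
qed

text \<open>A nondecreasing function stays below its limit. This stands in for comparing integrals
  over \<open>[x, \<infinity>)\<close>.\<close>

lemma deriv_nonneg_tendsto_0_imp_nonpos:
  fixes h :: "real \<Rightarrow> real"
  assumes "\<And>x. a \<le> x \<Longrightarrow> (h has_real_derivative h' x) (at x)" "\<And>x. a \<le> x \<Longrightarrow> 0 \<le> h' x"
    and "(h \<longlongrightarrow> 0) at_top" "a \<le> x"
  shows "h x \<le> 0"
proof (rule tendsto_lowerbound[OF assms(3)])
  show "\<forall>\<^sub>F y in at_top. h x \<le> h y"
    using eventually_ge_at_top[of x]
  proof eventually_elim
    case (elim y)
    show ?case
      by (rule DERIV_nonneg_imp_nondecreasing[OF elim]) (meson assms(1,2,4) order_trans)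
  qed
qed simp

text \<open>Eventually \<open>v\<close> lies between \<open>(c - d) * x powr (- \<eta> - 1)\<close>
  and \<open>(c + d) * x powr (- \<eta> - 1)\<close>. Comparing \<open>f\<close> with the
  antiderivatives of these bounds that vanish at infinity gives the limit.\<close>

lemma tendsto_powr_times_antiderivative:
  fixes f v :: "real \<Rightarrow> real"
  assumes "\<eta> > 0" and df: "\<And>x. x > 0 \<Longrightarrow> (f has_real_derivative - v x) (at x)"
    and f0: "(f \<longlongrightarrow> 0) at_top" and v: "((\<lambda>x. x powr (\<eta> + 1) * v x) \<longlongrightarrow> c) at_top"
  shows "((\<lambda>x. x powr \<eta> * f x) \<longlongrightarrow> c / \<eta>) at_top"
proof (rule tendstoI)
  fix e :: real assume "e > 0"
  \<comment> \<open>The comparison costs \<open>d / \<eta>\<close>, which is then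
    \<open>e / 2\<close>.\<close>
  define d where "d = e * \<eta> / 2"
  have "d > 0" using \<open>e > 0\<close> assms(1) by (simp add: d_def)
  have "\<forall>\<^sub>F x in at_top. \<bar>x powr (\<eta> + 1) * v x - c\<bar> < d"
    using tendstoD[OF v \<open>d > 0\<close>] by (simp add: dist_real_def)
  then obtain a0 where a0: "\<And>x. x \<ge> a0 \<Longrightarrow> \<bar>x powr (\<eta> + 1) * v x - c\<bar> < d"
    by (auto simp: eventually_at_top_linorder)
  define a where "a = max a0 1"
  have pw: "((\<lambda>x. x powr - \<eta>) has_real_derivative - \<eta> * x powr (- \<eta> - 1)) (at x)" if "x \<ge> a" for x
    using that by (intro has_real_derivative_powr) (auto simp: a_def)
  have pw0: "((\<lambda>x. x powr - \<eta>) \<longlongrightarrow> 0) at_top"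
    using assms(1) by (intro tendsto_neg_powr filterlim_ident) auto
  have v_bd: "(c - d) * x powr (- \<eta> - 1) \<le> v x" "v x \<le> (c + d) * x powr (- \<eta> - 1)" if "x \<ge> a" for x
  proof -
    have x: "x > 0" "x \<ge> a0" using that by (auto simp: a_def)
    have "v x = x powr (\<eta> + 1) * v x * x powr (- \<eta> - 1)"
      using x by (simp add: powr_add[symmetric] mult.commute mult.left_commute)
    moreover have "(c - d) * x powr (- \<eta> - 1) \<le> x powr (\<eta> + 1) * v x * x powr (- \<eta> - 1)"
      using a0[OF x(2)] by (intro mult_right_mono) auto
    moreover have "x powr (\<eta> + 1) * v x * x powr (- \<eta> - 1) \<le> (c + d) * x powr (- \<eta> - 1)"
      using a0[OF x(2)] by (intro mult_right_mono) auto
    ultimately show "(c - d) * x powr (- \<eta> - 1) \<le> v x" "v x \<le> (c + d) * x powr (- \<eta> - 1)" by linarith+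
  qed
  have pos: "x > 0" if "x \<ge> a" for x using that by (simp add: a_def)
  have lo: "(c - d) / \<eta> * x powr - \<eta> - f x \<le> 0" if "x \<ge> a" for x
  proof (rule deriv_nonneg_tendsto_0_imp_nonpos[OF _ _ _ that])
    show "((\<lambda>x. (c - d) / \<eta> * x powr - \<eta> - f x) has_real_derivative v x - (c - d) * x powr (- \<eta> - 1)) (at x)" if "x \<ge> a" for x
      by (rule DERIV_cong[OF DERIV_diff[OF DERIV_cmult[OF pw[OF that]] df[OF pos[OF that]]]]) (use assms(1) in simp)
    show "((\<lambda>x. (c - d) / \<eta> * x powr - \<eta> - f x) \<longlongrightarrow> 0) at_top"
      using tendsto_diff[OF tendsto_mult_left[OF pw0, of "(c - d) / \<eta>"] f0] by simp
  qed (use v_bd in simp)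
  have hi: "f x - (c + d) / \<eta> * x powr - \<eta> \<le> 0" if "x \<ge> a" for x
  proof (rule deriv_nonneg_tendsto_0_imp_nonpos[OF _ _ _ that])
    show "((\<lambda>x. f x - (c + d) / \<eta> * x powr - \<eta>) has_real_derivative (c + d) * x powr (- \<eta> - 1) - v x) (at x)" if "x \<ge> a" for x
      by (rule DERIV_cong[OF DERIV_diff[OF df[OF pos[OF that]] DERIV_cmult[OF pw[OF that]]]]) (use assms(1) in simp)
    show "((\<lambda>x. f x - (c + d) / \<eta> * x powr - \<eta>) \<longlongrightarrow> 0) at_top"
      using tendsto_diff[OF f0 tendsto_mult_left[OF pw0, of "(c + d) / \<eta>"]] by simp
  qed (use v_bd in simp)
  show "\<forall>\<^sub>F x in at_top. dist (x powr \<eta> * f x) (c / \<eta>) < e"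
    using eventually_ge_at_top[of a]
  proof eventually_elim
    case (elim x)
    have one: "x powr \<eta> * x powr - \<eta> = 1" using pos[OF elim] by (simp add: powr_add[symmetric])
    have "x powr \<eta> * ((c - d) / \<eta> * x powr - \<eta>) \<le> x powr \<eta> * f x"
      using lo[OF elim] by (intro mult_left_mono) auto
    moreover have "x powr \<eta> * ((c - d) / \<eta> * x powr - \<eta>) = (c - d) / \<eta>"
      using one by (metis mult.assoc mult.commute mult.right_neutral)
    moreover have "x powr \<eta> * f x \<le> x powr \<eta> * ((c + d) / \<eta> * x powr - \<eta>)"
      using hi[OF elim] by (intro mult_left_mono) auto
    moreover have "x powr \<eta> * ((c + d) / \<eta> * x powr - \<eta>) = (c + d) / \<eta>"
      using one by (metis mult.assoc mult.commute mult.right_neutral)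
    ultimately have "(c - d) / \<eta> \<le> x powr \<eta> * f x \<and> x powr \<eta> * f x \<le> (c + d) / \<eta>" by linarith
    then have "\<bar>x powr \<eta> * f x - c / \<eta>\<bar> \<le> d / \<eta>"
      by (auto simp add: abs_le_iff diff_divide_distrib add_divide_distrib)
    also have "d / \<eta> < e" using assms(1) \<open>e > 0\<close> by (simp add: d_def)
    finally show ?case by (simp add: dist_real_def)
  qed
qed

context emden_fowler
begin

context
  fixes u F
  assumes sol: "solves 1 u F" and pos: "\<And>r. r \<ge> 0 \<Longrightarrow> u r > 0"
begin

lemma positive_F_neg: "r > 0 \<Longrightarrow> F r < 0"
  by (rule F_neg[OF sol]) (use pos in \<open>auto intro: less_imp_le\<close>)

lemma positive_antimono: "0 \<le> x \<Longrightarrow> x \<le> y \<Longrightarrow> u y \<le> u x"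
  by (rule u_antimono[OF sol, of y]) (use pos in \<open>auto intro: less_imp_le\<close>)

text \<open>As \<open>u\<close> is monotone, it suffices to exclude a positive lower bound
  \<open>e\<close>.\<close>

lemma positive_tendsto_0: "(u \<longlongrightarrow> 0) at_top"
proof (rule order_tendstoI)
  fix e :: real assume "e < 0"
  then show "\<forall>\<^sub>F r in at_top. e < u r"
    by (intro eventually_mono[OF eventually_ge_at_top[of 0]]) (use pos in fastforce)
next
  fix e :: real assume e: "0 < e"
  have "\<exists>r\<ge>0. u r < e"
  proof (rule ccontr)
    assume "\<not> ?thesis"
    then have ge: "u r \<ge> e" if "r \<ge> 0" for r using that by force
    obtain B where B: "\<And>r. r \<ge> 0 \<Longrightarrow> \<bar>F r\<bar> \<le> B"
      using uniform_bound[of "\<bar>u 0\<bar>"] sol by blast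
    have "B \<ge> 0" using B[of 0] by simp
    \<comment> \<open>Beyond this radius the friction is at most
      \<open>(\<alpha> - 1) * e\<close>.\<close>
    define r0 where "r0 = (real N - 1) * B / ((\<alpha> - 1) * e) + 1"
    have r0: "r0 > 0" using \<open>B \<ge> 0\<close> N_ge_2 alpha_gt_1 e by (auto simp: r0_def intro!: add_nonneg_pos)
    \<comment> \<open>If \<open>u \<ge> e\<close> then \<open>h\<close> is eventually increasing because \<open>\<alpha> > \<delta> > 1\<close>, so \<open>- F\<close> grows linearly although it is bounded.\<close>
    define h where "h = (\<lambda>r. - F r - r * u r)"
    \<comment> \<open>At this radius \<open>R * e\<close> exceeds
      \<open>B + \<bar>h r0\<bar>\<close>, the upper bound for \<open>R * u R\<close> that follows
      from \<open>h r0 \<le> h R\<close>.\<close>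
    define R where "R = max r0 ((\<bar>h r0\<bar> + B + 1) / e)"
    have "h r0 \<le> h R"
    proof (rule DERIV_nonneg_imp_nondecreasing[where f = h])
      fix x assume x: "r0 \<le> x" "x \<le> R"
      then have x0: "x > 0" using r0 by simp
      have "(h has_real_derivative (real N - 1) / x * F x + (\<alpha> - 1) * u x + signed_pow q (u x)) (at x)"
        unfolding h_def
        by (rule DERIV_cong[OF DERIV_diff[OF DERIV_minus[OF deriv_F[OF sol x0]] DERIV_mult[OF DERIV_ident deriv_u[OF sol x0]]]])
           (simp add: algebra_simps)
      moreover have "- ((\<alpha> - 1) * e) \<le> (real N - 1) / x * F x"
      proof -
        have "(real N - 1) / x * - F x \<le> (real N - 1) / r0 * B"
          using x r0 N_ge_2 B[of x] positive_F_neg[OF x0]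
          by (intro mult_mono divide_left_mono) auto
        also have "\<dots> \<le> (\<alpha> - 1) * e"
        proof -
          define M where "M = (\<alpha> - 1) * e"
          have "M > 0" using alpha_gt_1 e by (simp add: M_def)
          then have "(real N - 1) * B \<le> M * r0"
            unfolding r0_def M_def[symmetric] by (simp add: distrib_left)
          then show ?thesis using r0 unfolding M_def[symmetric] by (simp add: pos_divide_le_eq)
        qed
        finally show ?thesis by simp
      qed
      moreover have "(\<alpha> - 1) * e \<le> (\<alpha> - 1) * u x" using ge[of x] x0 alpha_gt_1 by simp
      moreover have "signed_pow q (u x) \<ge> 0" using pos[of x] x0 by (simp add: signed_pow_nonneg)
      ultimately show "\<exists>y. (h has_real_derivative y) (at x) \<and> 0 \<le> y"
        by (intro exI conjI) (assumption, linarith)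
    qed (simp add: R_def)
    then have "R * u R \<le> - F R + \<bar>h r0\<bar>" by (simp add: h_def)
    moreover have "R > 0" using r0 by (simp add: R_def)
    then have "- F R \<le> B" "R * e \<le> R * u R" using B[of R] ge[of R] by auto
    moreover have "\<bar>h r0\<bar> + B + 1 \<le> R * e"
    proof -
      have "(\<bar>h r0\<bar> + B + 1) / e \<le> R" by (simp add: R_def)
      then show ?thesis using e by (simp add: field_simps)
    qed
    ultimately show False by simp
  qed
  then obtain r where "r \<ge> 0" "u r < e" by blast
  then show "\<forall>\<^sub>F r in at_top. u r < e"
    by (intro eventually_mono[OF eventually_ge_at_top[of r]]) (meson le_less_trans positive_antimono)
qed

text \<open>The hypothesis \<open>nonpos\<close> expresses that the mass criterion never applies. It
  bounds the eventually increasing \<open>mass\<close> by \<open>0\<close>; the limit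
  \<open>L\<close> turns out to be strictly negative and determines \<open>c\<close>.\<close>

lemma fast_decay:
  assumes nonpos: "\<And>R. R > 0 \<Longrightarrow> u R powr (q - 1) < real N - \<alpha> \<Longrightarrow> mass 1 u F R \<le> 0"
  shows "\<exists>c. c \<noteq> 0 \<and> ((\<lambda>r. r powr ((real N - p) / (p - 1)) * u r) \<longlongrightarrow> c) at_top"
proof -
  have "((\<lambda>r. u r powr (q - 1)) \<longlongrightarrow> 0 powr (q - 1)) at_top"
    by (rule tendsto_powr2[OF positive_tendsto_0 tendsto_const])
       (use q_gt_1 pos in \<open>auto intro!: eventually_mono[OF eventually_ge_at_top[of 0]] less_imp_le\<close>)
  then have "\<forall>\<^sub>F r in at_top. u r powr (q - 1) < (real N - \<alpha>) / 2"
    by (rule order_tendstoD) (use alpha_lt in simp)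
  then obtain r0' where r0': "\<And>r. r \<ge> r0' \<Longrightarrow> u r powr (q - 1) < (real N - \<alpha>) / 2"
    by (auto simp: eventually_at_top_linorder)
  define r0 where "r0 = max r0' 1"
  have r0: "r0 \<ge> 1" "\<And>r. r \<ge> r0 \<Longrightarrow> u r powr (q - 1) < (real N - \<alpha>) / 2"
    using r0' by (auto simp: r0_def)
  let ?m = "mass 1 u F"
  have dm: "r ^ (N - 1) * (1 * (real N - \<alpha>) * u r - signed_pow q (u r)) \<ge> (real N - \<alpha>) / 2 * (r ^ (N - 1) * u r)"
    if "r \<ge> r0" for r
  proof -
    have ur: "u r > 0" using pos[of r] that r0 by simp
    have "u r * ((real N - \<alpha>) / 2) \<le> u r * (real N - \<alpha> - u r powr (q - 1))"
      using r0(2)[OF that] ur by (intro mult_left_mono) auto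
    then have "r ^ (N - 1) * (u r * ((real N - \<alpha>) / 2)) \<le> r ^ (N - 1) * (u r * (real N - \<alpha> - u r powr (q - 1)))"
      by (rule mult_left_mono) (use that r0 in auto)
    then show ?thesis using ur by (simp add: signed_pow_def algebra_simps)
  qed
  \<comment> \<open>As \<open>u\<close> decreases, \<open>x ^ (N - 1) * u y\<close> is a constant
    lower bound for the integrand on \<open>[x, y]\<close>.\<close>
  have incr: "(real N - \<alpha>) / 2 * x ^ (N - 1) * u y * (y - x) \<le> ?m y - ?m x" if "r0 \<le> x" "x \<le> y" for x y
  proof -
    define c where "c = (real N - \<alpha>) / 2 * x ^ (N - 1) * u y"
    have "c * y - c * x \<le> ?m y - ?m x"
    proof (rule deriv_ge_imp_increment_ge[OF \<open>x \<le> y\<close>])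
      show "(?m has_real_derivative s ^ (N - 1) * (1 * (real N - \<alpha>) * u s - signed_pow q (u s))) (at s)" if "x < s" for s
        by (rule deriv_mass[OF sol]) (use that \<open>r0 \<le> x\<close> r0 in auto)
      show "((\<lambda>s. c * s) has_real_derivative c) (at s)" for s
        by (auto intro!: derivative_eq_intros)
      show "c \<le> s ^ (N - 1) * (1 * (real N - \<alpha>) * u s - signed_pow q (u s))" if s: "x < s" "s < y" for s
      proof -
        have "x ^ (N - 1) * u y \<le> s ^ (N - 1) * u s"
          using s \<open>r0 \<le> x\<close> r0 pos[of y] positive_antimono[of s y] by (intro mult_mono power_mono) auto
        then have "c \<le> (real N - \<alpha>) / 2 * (s ^ (N - 1) * u s)"
          unfolding c_def mult.assoc using alpha_lt by (intro mult_left_mono) auto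
        also have "\<dots> \<le> s ^ (N - 1) * (1 * (real N - \<alpha>) * u s - signed_pow q (u s))"
          by (rule dm) (use s \<open>r0 \<le> x\<close> in simp)
        finally show ?thesis .
      qed
    qed (use \<open>r0 \<le> x\<close> r0 in \<open>auto intro!: cont_mass[OF sol] continuous_intros\<close>)
    then show ?thesis unfolding c_def[symmetric] by (simp add: right_diff_distrib)
  qed
  have m_mono: "?m x \<le> ?m y" if "r0 \<le> x" "x \<le> y" for x y
  proof -
    have "0 \<le> (real N - \<alpha>) / 2 * x ^ (N - 1) * u y * (y - x)"
      using that r0 pos[of y] alpha_lt by auto
    with incr[OF that] show ?thesis by simp
  qed
  have m_nonpos: "?m x \<le> 0" if "r0 \<le> x" for x
    by (rule nonpos) (use r0(1) r0(2)[OF that] that alpha_lt in auto)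
  obtain L where L: "(?m \<longlongrightarrow> L) at_top" "L \<le> 0"
    using mono_bounded_tendsto_at_top[of r0 ?m 0, OF m_mono m_nonpos] by blast
  have half: "filterlim (\<lambda>r::real. r / 2) at_top at_top"
    by (rule filterlim_at_top_mult_tendsto_pos[of "\<lambda>_. 1/2", OF tendsto_const _ filterlim_ident, simplified])
  \<comment> \<open>Applied on \<open>[r / 2, r]\<close>, \<open>incr\<close> bounds
    \<open>r ^ N * u r\<close> by a multiple of a difference of masses with the same limit. The
    factor \<open>2 ^ N\<close> undoes the halving.\<close>
  have "((\<lambda>r. 2 ^ N * (2 / (real N - \<alpha>) * (?m r - ?m (r / 2)))) \<longlongrightarrow> 2 ^ N * (2 / (real N - \<alpha>) * (L - L))) at_top"
    by (intro tendsto_intros L(1) filterlim_compose[OF L(1) half])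
  then have up0: "((\<lambda>r. 2 ^ N * (2 / (real N - \<alpha>) * (?m r - ?m (r / 2)))) \<longlongrightarrow> 0) at_top" by simp
  have rNu: "((\<lambda>r. r ^ N * u r) \<longlongrightarrow> 0) at_top"
  proof (rule tendsto_sandwich[OF _ _ tendsto_const up0])
    show "\<forall>\<^sub>F r in at_top. 0 \<le> r ^ N * u r"
      using eventually_ge_at_top[of 0] by eventually_elim (use pos in \<open>auto intro!: mult_nonneg_nonneg less_imp_le[OF pos]\<close>)
    show "\<forall>\<^sub>F r in at_top. r ^ N * u r \<le> 2 ^ N * (2 / (real N - \<alpha>) * (?m r - ?m (r / 2)))"
      using eventually_ge_at_top[of "2 * r0"]
    proof eventually_elim
      case (elim r)
      have "(real N - \<alpha>) / 2 * (r / 2) ^ (N - 1) * u r * (r - r / 2) \<le> ?m r - ?m (r / 2)"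
        by (rule incr) (use elim r0 in auto)
      also have "(real N - \<alpha>) / 2 * (r / 2) ^ (N - 1) * u r * (r - r / 2) = (real N - \<alpha>) / 2 * (r / 2) ^ N * u r"
        by (simp add: power_N)
      finally have "2 / (real N - \<alpha>) * ((real N - \<alpha>) / 2 * (r / 2) ^ N * u r) \<le> 2 / (real N - \<alpha>) * (?m r - ?m (r / 2))"
        using alpha_lt by (intro mult_left_mono) auto
      then have "(r / 2) ^ N * u r \<le> 2 / (real N - \<alpha>) * (?m r - ?m (r / 2))"
        using alpha_lt by simp
      then have "2 ^ N * ((r / 2) ^ N * u r) \<le> 2 ^ N * (2 / (real N - \<alpha>) * (?m r - ?m (r / 2)))"
        by (rule mult_left_mono) simp
      then show ?case by (simp add: power_divide)
    qed
  qed
  define G where "G = (\<lambda>r. - (r ^ (N - 1) * F r))"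
  have G_lim: "(G \<longlongrightarrow> - L) at_top"
  proof -
    have "((\<lambda>r. r ^ N * u r - ?m r) \<longlongrightarrow> 0 - L) at_top" by (intro tendsto_diff rNu L)
    moreover have "(\<lambda>r. r ^ N * u r - ?m r) = G" by (auto simp: G_def mass_def power_N algebra_simps)
    ultimately show ?thesis by simp
  qed
  have G_pos: "G r > 0" if "r > 0" for r
    using positive_F_neg[OF that] that by (auto simp: G_def mult_pos_neg)
  \<comment> \<open>When \<open>r ^ (N - 1) * \<bar>F\<bar>\<close> is bounded,
    \<open>r * \<bar>F\<bar> powr (k - 1)\<close> is of order
    \<open>r powr (- \<sigma> - 1)\<close>. Integrability is \<open>\<sigma> > 0\<close>, that is,
    \<open>\<delta> < N\<close>.\<close>
  define \<sigma> where "\<sigma> = (real N - 1) * (k - 1) - 2"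
  have \<sigma>: "\<sigma> > 0"
  proof -
    have "k - 1 = (2 - p) / (p - 1)" using p_gt_1 by (simp add: k_def field_simps)
    moreover have "2 * (p - 1) < (real N - 1) * (2 - p)" using p_lt_N_frac by (simp add: algebra_simps)
    then have "2 < (real N - 1) * ((2 - p) / (p - 1))" using p_gt_1 by (simp add: pos_less_divide_eq)
    ultimately show ?thesis by (simp add: \<sigma>_def)
  qed
  have "\<forall>\<^sub>F r in at_top. G r < - L + 1" by (rule order_tendstoD[OF G_lim]) simp
  then obtain r1' where r1': "\<And>r. r \<ge> r1' \<Longrightarrow> G r < - L + 1" by (auto simp: eventually_at_top_linorder)
  define r1 where "r1 = max r1' 1"
  have r1: "r1 \<ge> 1" "\<And>r. r \<ge> r1 \<Longrightarrow> G r < - L + 1" using r1' by (auto simp: r1_def)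
  define C where "C = (- L + 1) powr (k - 1)"
  \<comment> \<open>\<open>G' \<ge> - C r\<^sup>-\<^sup>\<sigma>\<^sup>-\<^sup>1 G\<close>, and \<open>\<psi>\<close> absorbs the integrating factor, which stays bounded since \<open>\<sigma> > 0\<close>.\<close>
  define \<psi> where "\<psi> = (\<lambda>r. G r * exp (- (C / \<sigma> * r powr - \<sigma>)))"
  have \<psi>_mono: "\<psi> r1 \<le> \<psi> r" if "r \<ge> r1" for r
  proof (rule DERIV_nonneg_imp_nondecreasing[OF that, where f = \<psi>])
    fix x assume "r1 \<le> x" "x \<le> r"
    then have x: "x > 0" "x \<ge> r1" using r1 by auto
    have F: "F x < 0" by (rule positive_F_neg[OF x(1)])
    define D where "D = x ^ (N - 1) * (x * signed_pow k (F x) + \<alpha> * u x + signed_pow q (u x))"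
    have dG: "(G has_real_derivative D) (at x)"
      unfolding G_def
      by (rule DERIV_cong[OF DERIV_minus[OF DERIV_mult[OF power_N_1_deriv[OF x(1)] deriv_F[OF sol x(1)]]]])
         (simp add: D_def algebra_simps add_divide_distrib diff_divide_distrib)
    have "- (C * x powr (- \<sigma> - 1)) * G x \<le> D"
    proof -
      have Feq: "\<bar>F x\<bar> = G x * x powr (- (real N - 1))"
      proof -
        have "x ^ (N - 1) = x powr (real N - 1)"
          using x N_ge_2 by (simp add: powr_realpow[symmetric] N_eq_Suc(2))
        then have "G x * x powr (- (real N - 1)) = \<bar>F x\<bar> * (x powr (real N - 1) * x powr (- (real N - 1)))"
          using F by (simp add: G_def)
        also have "x powr (real N - 1) * x powr (- (real N - 1)) = 1"
          using x by (subst powr_add[symmetric]) simp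
        finally show ?thesis by simp
      qed
      have "\<bar>F x\<bar> powr (k - 1) = G x powr (k - 1) * x powr (- (real N - 1) * (k - 1))"
        using G_pos[OF x(1)] x unfolding Feq by (subst powr_mult) (auto simp: powr_powr)
      also have "\<dots> \<le> C * x powr (- (real N - 1) * (k - 1))"
        unfolding C_def using G_pos[OF x(1)] r1(2)[OF x(2)] k_gt_1
        by (intro mult_right_mono powr_mono2) auto
      finally have "x * \<bar>F x\<bar> powr (k - 1) \<le> x * (C * x powr (- (real N - 1) * (k - 1)))"
        using x by (intro mult_left_mono) auto
      also have "\<dots> = C * x powr (- \<sigma> - 1)"
      proof -
        have "x * x powr (- (real N - 1) * (k - 1)) = x powr (1 + - (real N - 1) * (k - 1))"
          using x by (simp add: powr_mult_base)
        also have "1 + - (real N - 1) * (k - 1) = - \<sigma> - 1" by (simp add: \<sigma>_def algebra_simps)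
        finally show ?thesis by (simp only: mult.left_commute[of x C])
      qed
      finally have "x * \<bar>F x\<bar> powr (k - 1) * G x \<le> C * x powr (- \<sigma> - 1) * G x"
        using G_pos[OF x(1)] by (intro mult_right_mono) auto
      moreover have "0 \<le> x ^ (N - 1) * (\<alpha> * u x + signed_pow q (u x))"
        using x pos[of x] alpha_gt_1 by (auto simp: signed_pow_nonneg intro!: mult_nonneg_nonneg add_nonneg_nonneg)
      moreover have "D = - (x * \<bar>F x\<bar> powr (k - 1) * G x) + x ^ (N - 1) * (\<alpha> * u x + signed_pow q (u x))"
        by (simp add: D_def G_def signed_pow_def[of k] algebra_simps)
      ultimately show ?thesis by simp
    qed
    moreover have "(\<psi> has_real_derivative exp (- (C / \<sigma> * x powr - \<sigma>)) * (D + C * x powr (- \<sigma> - 1) * G x)) (at x)"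
      unfolding \<psi>_def
      by (rule derivative_eq_intros dG refl has_real_derivative_powr x(1))+ (use \<sigma> in \<open>simp add: algebra_simps\<close>)
    ultimately show "\<exists>y. (\<psi> has_real_derivative y) (at x) \<and> 0 \<le> y"
      by (intro exI conjI) (assumption, simp)
  qed
  have "\<psi> r1 > 0" using G_pos[of r1] r1 by (simp add: \<psi>_def)
  \<comment> \<open>Since \<open>\<psi> \<le> G\<close>, the positive value \<open>\<psi> r1\<close>
    is a lower bound for \<open>G\<close> and so for its limit.\<close>
  have "\<psi> r1 \<le> - L"
  proof (rule tendsto_lowerbound[OF G_lim])
    show "\<forall>\<^sub>F r in at_top. \<psi> r1 \<le> G r"
      using eventually_ge_at_top[of r1]
    proof eventually_elim
      case (elim r)
      have "\<psi> r \<le> G r * 1" unfolding \<psi>_def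
        using G_pos[of r] elim r1 \<sigma> by (intro mult_left_mono) (auto simp: C_def)
      with \<psi>_mono[OF elim] show ?case by simp
    qed
  qed simp
  then have "- L > 0" using \<open>\<psi> r1 > 0\<close> by linarith
  \<comment> \<open>Because \<open>\<eta> + 1 = (N - 1) * k\<close>, the quantity
    \<open>r powr (\<eta> + 1) * \<bar>u'\<bar>\<close> is \<open>G r powr k\<close>, whose limit is
    known.\<close>
  define \<eta> where "\<eta> = (real N - p) / (p - 1)"
  have \<eta>: "\<eta> > 0" "\<eta> + 1 = (real N - 1) * k"
    using p_gt_1 p_lt_2 N_ge_2 by (auto simp: \<eta>_def k_def field_simps)
  have "((\<lambda>r. r powr \<eta> * u r) \<longlongrightarrow> (- L) powr k / \<eta>) at_top"
  proof (rule tendsto_powr_times_antiderivative[OF \<eta>(1) _ positive_tendsto_0])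
    show "(u has_real_derivative - (\<bar>F x\<bar> powr k)) (at x)" if "x > 0" for x
      using deriv_u[OF sol that] positive_F_neg[OF that] by (simp add: signed_pow_nonpos)
    have "((\<lambda>r. G r powr k) \<longlongrightarrow> (- L) powr k) at_top"
      by (intro tendsto_powr G_lim tendsto_const) (use \<open>- L > 0\<close> in auto)
    then show "((\<lambda>x. x powr (\<eta> + 1) * \<bar>F x\<bar> powr k) \<longlongrightarrow> (- L) powr k) at_top"
    proof (rule Lim_transform_eventually)
      show "\<forall>\<^sub>F x in at_top. G x powr k = x powr (\<eta> + 1) * \<bar>F x\<bar> powr k"
        using eventually_gt_at_top[of 0]
      proof eventually_elim
        case (elim x)
        have "G x = x powr (real N - 1) * \<bar>F x\<bar>"
          using elim positive_F_neg[OF elim] N_ge_2 by (simp add: G_def powr_realpow[symmetric] N_eq_Suc(2))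
        then show ?case using elim by (simp add: powr_mult powr_powr \<eta>(2))
      qed
    qed
  qed
  moreover have "(- L) powr k / \<eta> \<noteq> 0" using \<open>- L > 0\<close> \<eta> by auto
  ultimately show ?thesis unfolding \<eta>_def by blast
qed

end

subsection \<open>Sign change for large data\<close>

text \<open>The factor \<open>b\<close> is forced by \<open>w' = a * m * v'\<close> for the rescaled
  function \<open>v\<close>. The choice of \<open>m\<close> gives \<open>m * b = a powr q\<close>,
  so the nonlinear term keeps coefficient \<open>1\<close>, while drift and linear term acquire
  \<open>a / (m * b) = a powr (1 - q)\<close>.\<close>

lemma rescale:
  assumes sol: "solves 1 w F" and a: "w 0 = a" "a > 0"
    and m: "m = a powr ((q + 1 - p) / p)" and b: "b = (a * m) powr (p - 1)"
  shows "solves (a powr (1 - q)) (\<lambda>s. w (s / m) / a) (\<lambda>s. F (s / m) / b)"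
proof -
  have m0: "m > 0" and b0: "b > 0" using a by (auto simp: m b)
  have bm: "m * b = a powr q"
  proof -
    have "m * b = (m powr 1 * m powr (p - 1)) * a powr (p - 1)"
      using m0 a by (simp add: b powr_mult)
    also have "m powr 1 * m powr (p - 1) = m powr p" by (subst powr_add[symmetric]) simp
    also have "m powr p = a powr (q + 1 - p)" using p_gt_1 by (simp add: m powr_powr)
    also have "a powr (q + 1 - p) * a powr (p - 1) = a powr q" by (subst powr_add[symmetric]) simp
    finally show ?thesis .
  qed
  have phi: "signed_pow k (F x / b) = signed_pow k (F x) / (a * m)" for x
  proof -
    have "signed_pow k (1 / b * F x) = (1 / b) powr k * signed_pow k (F x)"
      by (rule signed_pow_scale) (use b0 in simp)
    moreover have "(1 / b) powr k = 1 / (a * m)"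
      using p_gt_1 a m0 by (simp add: b powr_divide powr_powr k_def)
    ultimately show ?thesis by simp
  qed
  have lin: "((\<lambda>s. s / m) has_real_derivative 1 / m) (at s within S)" for s S
    using m0 by (auto intro!: derivative_eq_intros)
  have gw: "signed_pow q x = a powr q * signed_pow q (x / a)" for x
    using signed_pow_scale[of a q "x / a"] a by simp
  show ?thesis
    unfolding solves_def
  proof (intro conjI allI impI)
    fix r :: real assume "r \<ge> 0"
    have "(w \<circ> (\<lambda>s. s / m) has_real_derivative signed_pow k (F (r / m)) * (1 / m)) (at r within {0..})"
    proof (rule DERIV_image_chain[OF has_field_derivative_subset[OF deriv_u_within[OF sol]] lin])
      show "(\<lambda>s. s / m) ` {0..} \<subseteq> {0..}" using m0 by auto
    qed (use \<open>r \<ge> 0\<close> m0 in simp)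
    from DERIV_cdivide[OF this, of a]
    show "((\<lambda>s. w (s / m) / a) has_real_derivative signed_pow k (F (r / m) / b)) (at r within {0..})"
      by (simp add: phi o_def field_simps)
  next
    show "continuous_on {0..} (\<lambda>s. F (s / m) / b)"
      by (intro continuous_intros continuous_on_compose2[OF cont_F[OF sol]]) (use m0 b0 in auto)
    show "F (0 / m) / b = 0" by (simp add: F_0[OF sol])
  next
    fix r :: real assume "r > 0"
    then have rm: "r / m > 0" using m0 by simp
    have ap: "a powr (1 - q) * a powr q = a"
      using a by (subst powr_add[symmetric]) simp
    have "((\<lambda>s. F (s / m)) has_real_derivative
        (- ((real N - 1) / (r / m) * F (r / m)) - 1 * (r / m * signed_pow k (F (r / m)) + \<alpha> * w (r / m))
         - signed_pow q (w (r / m))) * (1 / m)) (at r)"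
      by (rule DERIV_chain2[OF deriv_F[OF sol rm] lin])
    from DERIV_cdivide[OF this, of b]
    show "((\<lambda>s. F (s / m) / b) has_real_derivative
        - ((real N - 1) / r * (F (r / m) / b))
        - a powr (1 - q) * (r * signed_pow k (F (r / m) / b) + \<alpha> * (w (r / m) / a))
        - signed_pow q (w (r / m) / a)) (at r)"
    proof (rule DERIV_cong)
      define G Z W g where "G = F (r / m)" and "Z = signed_pow k (F (r / m))" and "W = w (r / m)"
        and "g = signed_pow q (w (r / m) / a)"
      define e where "e = a powr (1 - q)"
      have e: "a = e * (m * b)" using ap bm by (simp add: e_def)
      have e0: "e > 0" using a by (simp add: e_def)
      have "(- ((real N - 1) / (r / m) * G) - 1 * (r / m * Z + \<alpha> * W) - m * b * g) * (1 / m) / b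
         = - ((real N - 1) / r * (G / b)) - e * (r * (Z / (a * m)) + \<alpha> * (W / a)) - g"
        using m0 b0 \<open>r > 0\<close> e0 unfolding e by (simp add: field_simps)
      then show "(- ((real N - 1) / (r / m) * F (r / m)) - 1 * (r / m * signed_pow k (F (r / m)) + \<alpha> * w (r / m))
           - signed_pow q (w (r / m))) * (1 / m) / b
         = - ((real N - 1) / r * (F (r / m) / b))
        - a powr (1 - q) * (r * signed_pow k (F (r / m) / b) + \<alpha> * (w (r / m) / a))
        - signed_pow q (w (r / m) / a)"
        unfolding phi gw[of "w (r / m)"] G_def Z_def W_def g_def e_def bm .
    qed
  qed
qed

section \<open>Pohozaev's identity and decay for the rescaled equation\<close>

definition \<sigma> :: real where "\<sigma> = (real N - p) / p"

text \<open>The coefficient in Pohozaev's identity; subcriticality is exactly its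
  positivity.\<close>

definition \<kappa> :: real where "\<kappa> = real N / (q + 1) - \<sigma>"

text \<open>The scaling exponent of the Emden-Fowler equation, \<open>p / (q + 1 - p)\<close>: for
  \<open>r powr - \<beta>\<close> the operator and the power term have the same order.\<close>

definition \<beta> :: real where "\<beta> = (k + 1) / (q * k - 1)"

text \<open>The constant left by integrating the differential inequality in
  \<open>algebraic_decay\<close>. It does not involve \<open>\<epsilon>\<close>, so a radius can be
  fixed before \<open>\<epsilon>\<close>.\<close>

definition decay_const :: real where
  "decay_const = ((q * k - 1) / ((2 * real N) powr k * (k + 1))) powr (- (1 / (q * k - 1)))"

lemma sigma_nonneg: "\<sigma> \<ge> 0"
  using N_ge_2 p_lt_2 p_gt_1 by (simp add: \<sigma>_def)

lemma kappa_pos: "\<kappa> > 0"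
proof -
  have "(real N - p) / p < real N / (q + 1)"
    using subcritical p_gt_1 q_gt_1 by (simp add: pos_divide_less_eq pos_less_divide_eq)
  then show ?thesis by (simp add: \<kappa>_def \<sigma>_def)
qed

lemma qk_gt_1: "q * k > 1"
  using less_1_mult[OF q_gt_1 k_gt_1] .

lemma inverse_k_1: "1 / (k + 1) = (p - 1) / p" "k / (k + 1) = 1 / p"
  using p_gt_1 by (auto simp: k_def field_simps)

lemma beta_eq: "\<beta> = p / (q + 1 - p)"
proof -
  have "k + 1 = p / (p - 1)" "q * k - 1 = (q + 1 - p) / (p - 1)"
    using p_gt_1 by (auto simp: k_def field_simps)
  then show ?thesis using p_gt_1 by (simp add: \<beta>_def)
qed

text \<open>Both inequalities are subcriticality rewritten. They make the two exponents in
  \<open>large_radius_exists\<close> negative.\<close>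

lemma beta_gt: "real N < \<beta> * (q + 1)" "real N / p < \<beta> + 1"
proof -
  have pos: "q + 1 - p > 0" using p_lt_2 q_gt_1 by simp
  have "real N * (q + 1 - p) < p * (q + 1)" using subcritical by (simp add: algebra_simps)
  then show "real N < \<beta> * (q + 1)" using pos by (simp add: beta_eq pos_less_divide_eq)
  have "real N * (q + 1 - p) < (q + 1) * p" using subcritical by (simp add: algebra_simps)
  then have "real N / p < (q + 1) / (q + 1 - p)"
    using pos p_gt_1 by (simp add: frac_less_eq divide_less_eq pos_less_divide_eq)
  also have "\<dots> = \<beta> + 1" using pos by (simp add: beta_eq field_simps)
  finally show "real N / p < \<beta> + 1" .
qed

text \<open>The radial Pohozaev function for the multiplier \<open>r * u' + \<sigma> * u\<close>. It
  has no potential term in \<open>\<epsilon>\<close>, so \<open>\<epsilon>\<close> enters only its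
  derivative, as a perturbation.\<close>

definition pohozaev :: "(real \<Rightarrow> real) \<Rightarrow> (real \<Rightarrow> real) \<Rightarrow> real \<Rightarrow> real" where
  "pohozaev u F r = r ^ (N - 1) *
     (r * (\<bar>F r\<bar> powr (k + 1) / (k + 1) + \<bar>u r\<bar> powr (q + 1) / (q + 1)) + \<sigma> * (F r * u r))"

text \<open>The value of \<open>\<sigma>\<close> is the one for which the coefficient
  \<open>N / (k + 1) - (N - 1) + \<sigma>\<close> of \<open>F * u'\<close> vanishes. The coefficient
  of the power term is then \<open>\<kappa>\<close>.\<close>

lemma deriv_pohozaev:
  assumes sol: "solves \<epsilon> u F" and r: "r > 0"
  shows "(pohozaev u F has_real_derivative r ^ (N - 1) * (\<kappa> * \<bar>u r\<bar> powr (q + 1)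
     - \<epsilon> * ((r * signed_pow k (F r) + \<alpha> * u r) * (r * signed_pow k (F r) + \<sigma> * u r)))) (at r)"
proof -
  define c where "c = (real N - 1) / r"
  have cr: "c * r = real N - 1" using r by (simp add: c_def)
  let ?v = "signed_pow k (F r)" and ?g = "signed_pow q (u r)"
  let ?dF = "- (c * F r) - \<epsilon> * (r * ?v + \<alpha> * u r) - ?g"
  let ?A = "F r * ?v / (k + 1) + u r * ?g / (q + 1)"
  have dF: "(F has_real_derivative ?dF) (at r)" using deriv_F[OF sol r] by (simp only: c_def)
  note du = deriv_u[OF sol r]
  have 1: "((\<lambda>r. \<bar>F r\<bar> powr (k + 1) / (k + 1)) has_real_derivative ?v * ?dF) (at r)"
    by (rule DERIV_chain2[OF abs_powr_has_derivative dF]) (use k_gt_1 in simp)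
  have 2: "((\<lambda>r. \<bar>u r\<bar> powr (q + 1) / (q + 1)) has_real_derivative ?g * ?v) (at r)"
    by (rule DERIV_chain2[OF abs_powr_has_derivative du]) (use q_gt_1 in simp)
  have 3: "((\<lambda>r. r ^ (N - 1)) has_real_derivative c * r ^ (N - 1)) (at r)"
    using power_N_1_deriv[OF r] by (simp only: c_def)
  have "(pohozaev u F has_real_derivative c * r ^ (N - 1) * (r * ?A + \<sigma> * (F r * u r))
      + (1 * ?A + (?v * ?dF + ?g * ?v) * r + \<sigma> * (?dF * u r + ?v * F r)) * r ^ (N - 1)) (at r)"
    unfolding pohozaev_def [abs_def]
    by (rule DERIV_cong[OF DERIV_mult[OF 3 DERIV_add[OF DERIV_mult[OF DERIV_ident DERIV_add[OF 1 2]] DERIV_cmult[OF DERIV_mult[OF dF du]]]]])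
       (simp only: signed_pow_mult_self)
  moreover have "c * r ^ (N - 1) * (r * ?A + \<sigma> * (F r * u r))
      + (1 * ?A + (?v * ?dF + ?g * ?v) * r + \<sigma> * (?dF * u r + ?v * F r)) * r ^ (N - 1)
    = r ^ (N - 1) * (\<kappa> * (u r * ?g) - \<epsilon> * ((r * ?v + \<alpha> * u r) * (r * ?v + \<sigma> * u r)))"
  proof -
    \<comment> \<open>Naming the reciprocals, as \<open>c\<close> did for the friction coefficient,
      turns the claim into a polynomial identity modulo \<open>cr\<close> and
      \<open>z\<close>.\<close>
    define z y where "z = 1 / (k + 1)" and "y = 1 / (q + 1)"
    have z: "real N * z = real N - 1 - \<sigma>"
      unfolding z_def inverse_k_1(1) \<sigma>_def using p_gt_1 by (simp add: field_simps)
    have kap: "\<kappa> = real N * y - \<sigma>" by (simp add: \<kappa>_def y_def)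
    have A: "?A = F r * ?v * z + u r * ?g * y" by (simp add: z_def y_def)
    have "c * (r * A + \<sigma> * (f * x)) + (1 * A + (v * (- (c * f) - e - g) + g * v) * r + \<sigma> * ((- (c * f) - e - g) * x + v * f))
       = (c * r + 1) * A - (c * r) * (f * v) + \<sigma> * (f * v) - \<sigma> * (x * g) - e * (r * v + \<sigma> * x)"
      for A f x v e g :: real by (simp add: algebra_simps)
    note this[of ?A "F r" "u r" ?v "\<epsilon> * (r * ?v + \<alpha> * u r)" ?g]
    also have "(c * r + 1) * ?A - (c * r) * (F r * ?v) + \<sigma> * (F r * ?v) - \<sigma> * (u r * ?g) - \<epsilon> * (r * ?v + \<alpha> * u r) * (r * ?v + \<sigma> * u r)
       = (real N * z - (real N - 1) + \<sigma>) * (F r * ?v) + (real N * y - \<sigma>) * (u r * ?g) - \<epsilon> * (r * ?v + \<alpha> * u r) * (r * ?v + \<sigma> * u r)"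
      unfolding cr A by (simp add: algebra_simps)
    also have "\<dots> = \<kappa> * (u r * ?g) - \<epsilon> * ((r * ?v + \<alpha> * u r) * (r * ?v + \<sigma> * u r))"
      unfolding z kap by simp
    finally have eq: "c * (r * ?A + \<sigma> * (F r * u r)) + (1 * ?A + (?v * ?dF + ?g * ?v) * r + \<sigma> * (?dF * u r + ?v * F r))
      = \<kappa> * (u r * ?g) - \<epsilon> * ((r * ?v + \<alpha> * u r) * (r * ?v + \<sigma> * u r))" .
    have "c * P * X + Y * P = P * (c * X + Y)" for P X Y :: real by (simp add: algebra_simps)
    then show ?thesis by (simp only: eq)
  qed
  ultimately show ?thesis by (simp only: signed_pow_mult_self)
qed

lemma cont_pohozaev:
  assumes "solves \<epsilon> u F" "a \<ge> 0"
  shows "continuous_on {a..b} (pohozaev u F)"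
  unfolding pohozaev_def [abs_def]
  by (intro continuous_on_mult continuous_on_add continuous_on_divide continuous_on_power
        continuous_on_id continuous_on_const continuous_on_abs_powr cont_u_Icc[OF assms] cont_F_Icc[OF assms])
     (use k_gt_1 q_gt_1 in auto)

text \<open>By \<open>big\<close>, the linear term of \<open>mass\<close> is at most half of the
  power term up to \<open>r\<close>. This bounds \<open>- F t\<close> below by
  \<open>t * u t powr q / (2 * N)\<close>, hence gives a separable inequality for
  \<open>u'\<close>.\<close>

lemma algebraic_decay:
  assumes sol: "solves \<epsilon> u F" and "\<epsilon> \<ge> 0" and u0: "u 0 > 0" and nn: "\<And>s. s \<ge> 0 \<Longrightarrow> u s \<ge> 0"
    and r: "r > 0" and big: "2 * \<epsilon> * (real N - \<alpha>) \<le> u r powr (q - 1)"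
  shows "u r \<le> decay_const * r powr - \<beta>"
proof -
  have pos: "u s > 0" if "s \<ge> 0" for s
    by (rule nonneg_imp_pos[OF sol assms(2) u0 nn that])
  have anti: "u y \<le> u x" if "0 \<le> x" "x \<le> y" for x y
    by (rule u_antimono[OF sol assms(2) u0, of y]) (use nn that in auto)
  have F_ge: "t * u t powr q / (2 * real N) \<le> - F t" if t: "0 < t" "t \<le> r" for t
  proof -
    define c where "c = u t powr q / 2"
    have "c * (t ^ N / real N) - c * (0 ^ N / real N) \<le> - mass \<epsilon> u F t - (- mass \<epsilon> u F 0)"
    proof (rule deriv_ge_imp_increment_ge[where f = "\<lambda>s. - mass \<epsilon> u F s" and h = "\<lambda>s. c * (s ^ N / real N)"])
      fix s assume s: "0 < s" "s < t"
      show "((\<lambda>s. - mass \<epsilon> u F s) has_real_derivative - (s ^ (N - 1) * (\<epsilon> * (real N - \<alpha>) * u s - signed_pow q (u s)))) (at s)"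
        by (rule DERIV_minus[OF deriv_mass[OF sol s(1)]])
      show "((\<lambda>s. c * (s ^ N / real N)) has_real_derivative c * s ^ (N - 1)) (at s)"
        by (rule DERIV_cmult[OF power_N_div_deriv])
      have us: "u s > 0" "u r \<le> u s" "u t \<le> u s" using pos[of s] anti[of s r] anti[of s t] s t by auto
      have "2 * \<epsilon> * (real N - \<alpha>) \<le> u s powr (q - 1)"
        using big powr_mono2[of "q - 1" "u r" "u s"] us pos[of r] r q_gt_1 by simp
      then have "u s * (2 * \<epsilon> * (real N - \<alpha>)) \<le> u s * u s powr (q - 1)"
        using us by (intro mult_left_mono) auto
      also have "u s * u s powr (q - 1) = u s powr q" using us by (simp add: powr_mult_base)
      finally have "\<epsilon> * (real N - \<alpha>) * u s \<le> u s powr q / 2" by (simp add: algebra_simps)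
      moreover have "u t powr q \<le> u s powr q" using us pos[of t] t q_gt_1 by (intro powr_mono2) auto
      ultimately have "c \<le> - (\<epsilon> * (real N - \<alpha>) * u s - signed_pow q (u s))"
        using us by (simp add: c_def signed_pow_nonneg)
      then have "s ^ (N - 1) * c \<le> s ^ (N - 1) * - (\<epsilon> * (real N - \<alpha>) * u s - signed_pow q (u s))"
        using s by (intro mult_left_mono) auto
      then show "c * s ^ (N - 1) \<le> - (s ^ (N - 1) * (\<epsilon> * (real N - \<alpha>) * u s - signed_pow q (u s)))"
        by (metis mult.commute mult_minus_right)
    qed (use t N_ge_2 in \<open>auto intro!: continuous_intros cont_mass[OF sol]\<close>)
    then have "c * (t ^ N / real N) \<le> t ^ (N - 1) * (- F t - \<epsilon> * t * u t)"
      using N_ge_2 by (simp add: mass_0[OF sol] zero_power) (simp add: mass_def algebra_simps)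
    also have "\<dots> \<le> t ^ (N - 1) * - F t"
      using t assms(2) pos[of t] by (intro mult_left_mono) auto
    finally have "t ^ (N - 1) * (t * c / real N) \<le> t ^ (N - 1) * - F t"
      by (simp add: power_N algebra_simps)
    then have "t * c / real N \<le> - F t"
      using t by (subst (asm) mult_le_cancel_left_pos) auto
    then show ?thesis by (simp add: c_def)
  qed
  define \<gamma> where "\<gamma> = q * k - 1"
  have \<gamma>: "\<gamma> > 0" using qk_gt_1 by (simp add: \<gamma>_def)
  define C where "C = \<gamma> / ((2 * real N) powr k * (k + 1))"
  have C: "C > 0" using \<gamma> k_gt_1 N_ge_2 by (simp add: C_def)
  \<comment> \<open>Separation of variables: dividing by \<open>u powr (q * k)\<close> and
    integrating produces \<open>u powr - \<gamma>\<close> with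
    \<open>\<gamma> = q * k - 1\<close>.\<close>
  have "C * r powr (k + 1) - C * 0 powr (k + 1) \<le> u r powr - \<gamma> - u 0 powr - \<gamma>"
  proof (rule deriv_ge_imp_increment_ge[where f = "\<lambda>t. u t powr - \<gamma>" and h = "\<lambda>t. C * t powr (k + 1)"])
    show "continuous_on {0..r} (\<lambda>t. u t powr - \<gamma>)"
      by (intro continuous_intros cont_u_Icc[OF sol]) (use pos in force)+
    show "continuous_on {0..r} (\<lambda>t. C * t powr (k + 1))"
      by (intro continuous_intros continuous_on_powr') (use k_gt_1 in auto)
    fix t assume t: "0 < t" "t < r"
    have Ft: "F t < 0" by (rule F_neg[OF sol assms(2) u0]) (use nn t in auto)
    have ut: "u t > 0" using pos t by simp
    show "((\<lambda>t. C * t powr (k + 1)) has_real_derivative C * ((k + 1) * t powr k)) (at t)"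
      by (rule DERIV_cong[OF DERIV_cmult[OF has_real_derivative_powr[OF t(1)]]]) simp
    show "((\<lambda>t. u t powr - \<gamma>) has_real_derivative (- \<gamma> * u t powr (- \<gamma> - 1)) * signed_pow k (F t)) (at t)"
      by (rule DERIV_chain2[OF has_real_derivative_powr[OF ut] deriv_u[OF sol t(1)]])
    have "(t * u t powr q / (2 * real N)) powr k \<le> (- F t) powr k"
      using F_ge[of t] t k_gt_1 by (intro powr_mono2) auto
    then have "u t powr (- \<gamma> - 1) * (t * u t powr q / (2 * real N)) powr k \<le> u t powr (- \<gamma> - 1) * (- F t) powr k"
      by (intro mult_left_mono) auto
    moreover have "u t powr (- \<gamma> - 1) * (t * u t powr q / (2 * real N)) powr k = t powr k / (2 * real N) powr k"
    proof -
      have "u t powr (- \<gamma> - 1) * (t * u t powr q / (2 * real N)) powr k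
        = u t powr (- \<gamma> - 1) * (t powr k * u t powr (q * k) / (2 * real N) powr k)"
        using t ut by (simp add: powr_mult powr_divide powr_powr)
      also have "\<dots> = u t powr (- \<gamma> - 1) * u t powr (q * k) * (t powr k / (2 * real N) powr k)" by simp
      also have "u t powr (- \<gamma> - 1) * u t powr (q * k) = 1"
        using ut by (subst powr_add[symmetric]) (simp add: \<gamma>_def)
      finally show ?thesis by simp
    qed
    ultimately have "t powr k / (2 * real N) powr k \<le> u t powr (- \<gamma> - 1) * (- F t) powr k" by simp
    then have "\<gamma> * (t powr k / (2 * real N) powr k) \<le> \<gamma> * (u t powr (- \<gamma> - 1) * (- F t) powr k)"
      using \<gamma> by (intro mult_left_mono) auto
    moreover have "C * ((k + 1) * t powr k) = \<gamma> * (t powr k / (2 * real N) powr k)"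
      using k_gt_1 by (simp add: C_def)
    ultimately show "C * ((k + 1) * t powr k) \<le> (- \<gamma> * u t powr (- \<gamma> - 1)) * signed_pow k (F t)"
      using Ft by (simp add: signed_pow_nonpos algebra_simps)
  qed (use r in simp)
  then have "C * r powr (k + 1) \<le> u r powr - \<gamma> - u 0 powr - \<gamma>" using k_gt_1 by simp
  also have "\<dots> \<le> u r powr - \<gamma>" by simp
  finally have "C * r powr (k + 1) \<le> u r powr - \<gamma>" .
  then have "(u r powr - \<gamma>) powr (- (1 / \<gamma>)) \<le> (C * r powr (k + 1)) powr (- (1 / \<gamma>))"
    using \<gamma> C r by (intro powr_mono2') auto
  moreover have "(u r powr - \<gamma>) powr (- (1 / \<gamma>)) = u r"
    using \<gamma> pos[of r] r by (simp add: powr_powr)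
  moreover have "(C * r powr (k + 1)) powr (- (1 / \<gamma>)) = decay_const * r powr - \<beta>"
  proof -
    have "decay_const = C powr (- (1 / \<gamma>))" by (simp only: decay_const_def C_def \<gamma>_def)
    then show ?thesis using C r \<gamma> by (simp add: powr_mult powr_powr \<beta>_def \<gamma>_def[symmetric])
  qed
  ultimately show ?thesis by simp
qed

lemma decay_const_pos: "decay_const > 0"
  using qk_gt_1 k_gt_1 N_ge_2 by (simp add: decay_const_def)

text \<open>For \<open>u\<close> below the decay bound, the first inequality makes the potential
  part of the Pohozaev function at most \<open>c\<close> on \<open>[R, 2 * R]\<close>. The second
  says that the slope then forced by the kinetic part takes \<open>u\<close> below \<open>0\<close>
  within that interval.\<close>

lemma large_radius_exists:
  assumes c: "c > 0"
  shows "\<exists>R\<ge>1. (2 * R) ^ N * (decay_const * R powr - \<beta>) powr (q + 1) \<le> c \<and>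
     decay_const * R powr - \<beta> < R * ((k + 1) * c / (2 * R) ^ N) powr (1 / p)"
proof -
  define D where "D = decay_const"
  define H where "H = ((k + 1) * c / 2 ^ N) powr (1 / p)"
  have D: "D > 0" using decay_const_pos by (simp add: D_def)
  have H: "H > 0" using c k_gt_1 by (simp add: H_def)
  define e1 where "e1 = real N - \<beta> * (q + 1)"
  define e2 where "e2 = real N / p - 1 - \<beta>"
  have e: "e1 < 0" "e2 < 0" using beta_gt by (auto simp: e1_def e2_def)
  have "((\<lambda>R. 2 ^ N * D powr (q + 1) * R powr e1) \<longlongrightarrow> 2 ^ N * D powr (q + 1) * 0) at_top"
    "((\<lambda>R. D * R powr e2) \<longlongrightarrow> D * 0) at_top"
    by (rule tendsto_mult tendsto_const tendsto_neg_powr filterlim_ident e)+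
  then have "\<forall>\<^sub>F R in at_top. 2 ^ N * D powr (q + 1) * R powr e1 < c" "\<forall>\<^sub>F R in at_top. D * R powr e2 < H"
    using c H by (auto intro!: order_tendstoD)
  then have "\<forall>\<^sub>F R in at_top. 2 ^ N * D powr (q + 1) * R powr e1 < c \<and> D * R powr e2 < H \<and> R \<ge> 1"
    using eventually_ge_at_top[of 1] by eventually_elim auto
  then obtain R where R: "2 ^ N * D powr (q + 1) * R powr e1 < c" "D * R powr e2 < H" "R \<ge> 1"
    unfolding eventually_at_top_linorder by blast
  have "(2 * R) ^ N * (D * R powr - \<beta>) powr (q + 1) = 2 ^ N * D powr (q + 1) * R powr e1"
  proof -
    have "R powr e1 = R ^ N * R powr (- \<beta> * (q + 1))"
      using R by (simp add: e1_def powr_diff powr_minus powr_realpow divide_inverse)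
    then show ?thesis using D R by (simp add: powr_mult powr_powr power_mult_distrib)
  qed
  then have "(2 * R) ^ N * (D * R powr - \<beta>) powr (q + 1) \<le> c" using R(1) by linarith
  moreover have "D * R powr - \<beta> < R * ((k + 1) * c / (2 * R) ^ N) powr (1 / p)"
  proof -
    define A where "A = (k + 1) * c / 2 ^ N"
    have A: "A > 0" using c k_gt_1 by (simp add: A_def)
    have "(k + 1) * c / (2 * R) ^ N = A * R powr - real N"
      using R by (simp add: A_def power_mult_distrib powr_minus powr_realpow field_simps)
    then have "((k + 1) * c / (2 * R) ^ N) powr (1 / p) = (A * R powr - real N) powr (1 / p)" by simp
    also have "\<dots> = H * R powr (- real N / p)"
      using A R by (simp add: powr_mult powr_powr H_def A_def[symmetric])
    finally have a1: "((k + 1) * c / (2 * R) ^ N) powr (1 / p) = H * R powr (- real N / p)" .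
    have a2: "D * R powr - \<beta> = D * R powr e2 * (R * R powr (- real N / p))"
    proof -
      have "R powr e2 * (R powr 1 * R powr (- real N / p)) = R powr - \<beta>"
        by (simp only: powr_add[symmetric]) (simp add: e2_def)
      then show ?thesis using R by simp
    qed
    have "D * R powr e2 * (R * R powr (- real N / p)) < H * (R * R powr (- real N / p))"
      using R by (intro mult_strict_right_mono) auto
    then show ?thesis unfolding a1 a2 by (simp only: mult.left_commute[of R H])
  qed
  ultimately show ?thesis using R unfolding D_def by blast
qed

text \<open>A nonnegative solution gains a fixed amount \<open>c\<close> of Pohozaev function near
  \<open>0\<close> and loses at most \<open>c / 2\<close> up to \<open>2 * R\<close>. On
  \<open>[R, 2 * R]\<close> its decay leaves this to the kinetic part, so \<open>u\<close> falls too
  steeply to stay nonnegative. The constants \<open>c\<close> and \<open>R\<close> are fixed before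
  \<open>\<epsilon>\<close>.\<close>

lemma sign_change_for_small_parameter:
  "\<exists>\<epsilon>>0. \<forall>u F. solves \<epsilon> u F \<longrightarrow> u 0 = 1 \<longrightarrow> (\<exists>r\<ge>0. u r < 0)"
proof -
  \<comment> \<open>For \<open>\<epsilon> \<le> 1\<close> and \<open>u 0 = 1\<close>,
    \<open>B\<close> bounds \<open>\<bar>F\<bar>\<close> through the energy; \<open>V\<close> then
    bounds \<open>\<bar>u'\<bar>\<close>.\<close>
  define B where "B = (k + 1) * (\<alpha> / 2 + 1)"
  define V where "V = B powr k"
  have B: "B \<ge> 1" using k_gt_1 alpha_gt_1 mult_mono[of 1 "k + 1" 1 "\<alpha> / 2 + 1"] by (simp add: B_def)
  have V: "V \<ge> 1" using B k_gt_1 by (simp add: V_def ge_one_powr_ge_zero)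
  \<comment> \<open>Up to this radius \<open>u\<close> cannot fall below \<open>1 / 2\<close>, so
    \<open>c\<close> below bounds the gain of the Pohozaev function from below.\<close>
  define r0 where "r0 = 1 / (2 * V)"
  have r0: "r0 > 0" "r0 \<le> 1" using V by (auto simp: r0_def)
  define d where "d = \<kappa> * (1 / 2) powr (q + 1)"
  have d: "d > 0" using kappa_pos by (simp add: d_def)
  define c where "c = d * (r0 ^ N / real N)"
  have c: "c > 0" using d r0 N_ge_2 by (simp add: c_def)
  obtain R where R: "R \<ge> 1" "(2 * R) ^ N * (decay_const * R powr - \<beta>) powr (q + 1) \<le> c / 4"
     "decay_const * R powr - \<beta> < R * ((k + 1) * (c / 4) / (2 * R) ^ N) powr (1 / p)"
    using large_radius_exists[of "c / 4"] c by auto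
  define U where "U = decay_const * R powr - \<beta>"
  have U: "U > 0" using decay_const_pos R by (simp add: U_def)
  \<comment> \<open>Bounds the product that multiplies \<open>\<epsilon>\<close> in
    \<open>deriv_pohozaev\<close> on \<open>(0, 2 * R]\<close>.\<close>
  define Ce where "Ce = (2 * R * V + \<alpha>) * (2 * R * V + \<sigma>)"
  have Ce: "Ce \<ge> 0" using R V alpha_gt_1 sigma_nonneg by (simp add: Ce_def)
  \<comment> \<open>The three entries serve the energy bound, an error of at most
    \<open>c / 2\<close> on \<open>[0, 2 * R]\<close>, and the estimate \<open>u R \<le> U\<close>
    where \<open>algebraic_decay\<close> does not apply. The added \<open>1\<close> keeps the
    denominator positive.\<close>
  define \<epsilon> where "\<epsilon> = Min {1, c / 2 / (Ce * ((2 * R) ^ N / real N) + 1), U powr (q - 1) / (2 * (real N - \<alpha>))}"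
  have eps: "\<epsilon> > 0" "\<epsilon> \<le> 1" "\<epsilon> \<le> c / 2 / (Ce * ((2 * R) ^ N / real N) + 1)" "\<epsilon> \<le> U powr (q - 1) / (2 * (real N - \<alpha>))"
  proof -
    have "Ce * ((2 * R) ^ N / real N) + 1 > 0" using Ce R by (intro add_nonneg_pos) auto
    then show "\<epsilon> > 0" using c U alpha_lt by (simp add: \<epsilon>_def)
  qed (simp_all add: \<epsilon>_def)
  have eps_Ce: "\<epsilon> * Ce * ((2 * R) ^ N / real N) \<le> c / 2"
  proof -
    have "Ce * ((2 * R) ^ N / real N) + 1 > 0" using Ce R by (intro add_nonneg_pos) auto
    then have "\<epsilon> * (Ce * ((2 * R) ^ N / real N) + 1) \<le> c / 2" using eps(3) by (simp only: pos_le_divide_eq)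
    then show ?thesis using eps(1) by (simp add: distrib_left mult.assoc)
  qed
  have eps_U: "2 * \<epsilon> * (real N - \<alpha>) \<le> U powr (q - 1)"
    using eps(4) alpha_lt by (simp add: pos_le_divide_eq mult.commute mult.left_commute)
  have "\<exists>r\<ge>0. u r < 0" if sol: "solves \<epsilon> u F" and u1: "u 0 = 1" for u F
  proof (rule ccontr)
    assume "\<not> ?thesis"
    then have nn: "u r \<ge> 0" if "r \<ge> 0" for r using that by force
    have eps0: "\<epsilon> \<ge> 0" and u0: "u 0 > 0" using eps u1 by auto
    have anti: "u y \<le> u x" if "0 \<le> x" "x \<le> y" for x y
      by (rule u_antimono[OF sol eps0 u0, of y]) (use nn that in auto)
    have le1: "u r \<le> 1" if "r \<ge> 0" for r using anti[of 0 r] that u1 by simp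
    have Fneg: "F r < 0" if "r > 0" for r
      by (rule F_neg[OF sol eps0 u0]) (use nn that in auto)
    have "energy \<epsilon> u F 0 \<le> \<alpha> / 2 + 1"
    proof -
      have "\<epsilon> * \<alpha> \<le> 1 * \<alpha>" using eps alpha_gt_1 by (intro mult_right_mono) auto
      moreover have "1 / (q + 1) \<le> 1" using q_gt_1 by simp
      ultimately show ?thesis using k_gt_1 by (simp add: energy_def u1 F_0[OF sol])
    qed
    then have "(k + 1) * energy \<epsilon> u F 0 \<le> B" using k_gt_1 by (simp add: B_def)
    then have FB: "\<bar>F r\<bar> \<le> B" if "r \<ge> 0" for r
      using F_bound[OF sol eps0 that] B by simp
    have vV: "\<bar>signed_pow k (F r)\<bar> \<le> V" if "r \<ge> 0" for r
      unfolding abs_signed_pow V_def using FB[OF that] k_gt_1 by (intro powr_mono2) auto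
    have half: "u s \<ge> 1 / 2" if "0 \<le> s" "s \<le> r0" for s
    proof -
      have "- V * s - - V * 0 \<le> u s - u 0"
      proof (rule deriv_ge_imp_increment_ge[where f = u and h = "\<lambda>x. - V * x"])
        fix x assume x: "0 < x" "x < s"
        show "(u has_real_derivative signed_pow k (F x)) (at x)" by (rule deriv_u[OF sol x(1)])
        show "((\<lambda>x. - V * x) has_real_derivative - V) (at x)" by (rule DERIV_cmult_Id)
        show "- V \<le> signed_pow k (F x)" using vV[of x] x by simp
      qed (use that in \<open>auto intro!: continuous_intros cont_u_Icc[OF sol]\<close>)
      moreover have "V * s \<le> V * r0" using that V by (intro mult_left_mono) auto
      moreover have "V * r0 = 1 / 2" using V by (simp add: r0_def)
      ultimately show ?thesis using u1 by simp
    qed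
    let ?P = "pohozaev u F"
    define P' where "P' = (\<lambda>r. r ^ (N - 1) * (\<kappa> * \<bar>u r\<bar> powr (q + 1)
     - \<epsilon> * ((r * signed_pow k (F r) + \<alpha> * u r) * (r * signed_pow k (F r) + \<sigma> * u r))))"
    \<comment> \<open>Adding the worst possible error makes the function nondecreasing on
      \<open>[0, 2 * R]\<close>.\<close>
    define Q where "Q = (\<lambda>r. ?P r + \<epsilon> * Ce * (r ^ N / real N))"
    have dQ: "(Q has_real_derivative P' r + \<epsilon> * Ce * r ^ (N - 1)) (at r)" if "r > 0" for r
      unfolding Q_def P'_def
      by (rule DERIV_add[OF deriv_pohozaev[OF sol that] DERIV_cmult[OF power_N_div_deriv]])
    have cQ: "continuous_on {a..b} Q" if "a \<ge> 0" for a b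
      unfolding Q_def using that N_ge_2 by (intro continuous_intros cont_pohozaev[OF sol]) auto
    have Q'_ge: "r ^ (N - 1) * (\<kappa> * \<bar>u r\<bar> powr (q + 1)) \<le> P' r + \<epsilon> * Ce * r ^ (N - 1)" if r: "0 < r" "r \<le> 2 * R" for r
    proof -
      have b: "\<bar>r * signed_pow k (F r) + x * u r\<bar> \<le> 2 * R * V + x" if "x \<ge> 0" for x
      proof -
        have "\<bar>r * signed_pow k (F r) + x * u r\<bar> \<le> \<bar>r * signed_pow k (F r)\<bar> + \<bar>x * u r\<bar>" by (rule abs_triangle_ineq)
        also have "\<dots> = r * \<bar>signed_pow k (F r)\<bar> + x * u r" using r nn[of r] that by (simp add: abs_mult)
        also have "\<dots> \<le> 2 * R * V + x * 1"
          using r vV[of r] V le1[of r] nn[of r] that by (intro add_mono mult_mono) auto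
        finally show ?thesis by simp
      qed
      have "(r * signed_pow k (F r) + \<alpha> * u r) * (r * signed_pow k (F r) + \<sigma> * u r)
          \<le> \<bar>r * signed_pow k (F r) + \<alpha> * u r\<bar> * \<bar>r * signed_pow k (F r) + \<sigma> * u r\<bar>"
        by (simp add: abs_mult[symmetric])
      also have "\<dots> \<le> Ce" unfolding Ce_def
        using b[of \<alpha>] b[of \<sigma>] alpha_gt_1 sigma_nonneg R V by (intro mult_mono) auto
      finally have "\<epsilon> * ((r * signed_pow k (F r) + \<alpha> * u r) * (r * signed_pow k (F r) + \<sigma> * u r)) \<le> \<epsilon> * Ce"
        using eps by (intro mult_left_mono) auto
      then have "r ^ (N - 1) * (\<kappa> * \<bar>u r\<bar> powr (q + 1) - \<epsilon> * Ce) \<le> P' r"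
        unfolding P'_def using r by (intro mult_left_mono) auto
      then show ?thesis by (simp only: right_diff_distrib mult.commute[of "r ^ (N - 1)" "\<epsilon> * Ce"] diff_le_eq)
    qed
    have Qr0: "c \<le> Q r0"
    proof -
      have "d * (r0 ^ N / real N) - d * (0 ^ N / real N) \<le> Q r0 - Q 0"
      proof (rule deriv_ge_imp_increment_ge[where f = Q and h = "\<lambda>r. d * (r ^ N / real N)"])
        fix x assume x: "0 < x" "x < r0"
        show "(Q has_real_derivative P' x + \<epsilon> * Ce * x ^ (N - 1)) (at x)" by (rule dQ[OF x(1)])
        show "((\<lambda>r. d * (r ^ N / real N)) has_real_derivative d * x ^ (N - 1)) (at x)"
          by (rule DERIV_cmult[OF power_N_div_deriv])
        have "d \<le> \<kappa> * \<bar>u x\<bar> powr (q + 1)"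
          unfolding d_def using half[of x] x kappa_pos q_gt_1 by (intro mult_left_mono powr_mono2) auto
        then have "d * x ^ (N - 1) \<le> x ^ (N - 1) * (\<kappa> * \<bar>u x\<bar> powr (q + 1))"
          using x by (simp add: mult.commute)
        also have "\<dots> \<le> P' x + \<epsilon> * Ce * x ^ (N - 1)" by (rule Q'_ge) (use x r0 R in auto)
        finally show "d * x ^ (N - 1) \<le> P' x + \<epsilon> * Ce * x ^ (N - 1)" .
      qed (use r0 N_ge_2 cQ in \<open>auto intro!: continuous_intros\<close>)
      then show ?thesis using N_ge_2 by (simp add: c_def Q_def pohozaev_def zero_power)
    qed
    have P_ge: "c / 2 \<le> ?P r" if r: "R \<le> r" "r \<le> 2 * R" for r
    proof -
      have "Q r0 \<le> Q r"
      proof (rule DERIV_nonneg_imp_increasing_open[where f = Q])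
        fix x assume x: "r0 < x" "x < r"
        have "0 \<le> x ^ (N - 1) * (\<kappa> * \<bar>u x\<bar> powr (q + 1))" using x r0 kappa_pos by simp
        also have "\<dots> \<le> P' x + \<epsilon> * Ce * x ^ (N - 1)" by (rule Q'_ge) (use x r r0 in auto)
        finally show "\<exists>y. (Q has_real_derivative y) (at x) \<and> 0 \<le> y"
          using dQ[of x] x r0 by (intro exI conjI) auto
      qed (use r r0 R cQ in auto)
      moreover have "\<epsilon> * Ce * (r ^ N / real N) \<le> \<epsilon> * Ce * ((2 * R) ^ N / real N)"
        using r R eps Ce by (intro mult_left_mono divide_right_mono power_mono) auto
      ultimately show ?thesis using Qr0 eps_Ce by (simp only: Q_def)
    qed
    \<comment> \<open>Either the decay estimate applies at \<open>R\<close>, or \<open>u R\<close>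
      is already below the threshold, which \<open>eps_U\<close> places under
      \<open>U\<close>.\<close>
    have uR: "u R \<le> U"
    proof (cases "2 * \<epsilon> * (real N - \<alpha>) \<le> u R powr (q - 1)")
      case True
      then show ?thesis unfolding U_def by (intro algebraic_decay[OF sol eps0 u0 nn]) (use R in auto)
    next
      case False
      then have "u R powr (q - 1) < U powr (q - 1)" using eps_U by simp
      then show ?thesis using powr_mono2[of "q - 1" U "u R"] q_gt_1 U by (cases "u R \<le> U") auto
    qed
    \<comment> \<open>A lower bound for \<open>\<bar>F\<bar> powr (k + 1)\<close>: of the
      \<open>c / 2\<close> available, the potential part takes at most \<open>c / 4\<close> and the
      term with \<open>\<sigma>\<close> is nonpositive. Its \<open>p\<close>-th root bounds
      \<open>\<bar>u'\<bar>\<close>, because \<open>(k + 1) / p = k\<close>.\<close>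
    define Z where "Z = (k + 1) * (c / 4) / (2 * R) ^ N"
    have Z: "Z > 0" using c k_gt_1 R by (simp add: Z_def)
    have v_ge: "signed_pow k (F r) \<le> - (Z powr (1 / p))" if r: "R \<le> r" "r \<le> 2 * R" for r
    proof -
      have r1: "r > 0" using r R by simp
      define f where "f = \<bar>F r\<bar> powr (k + 1) / (k + 1)"
      define g where "g = \<bar>u r\<bar> powr (q + 1) / (q + 1)"
      have f0: "f \<ge> 0" using k_gt_1 by (simp add: f_def)
      have "?P r = r ^ N * f + r ^ N * g + r ^ (N - 1) * (\<sigma> * (F r * u r))"
        by (simp add: pohozaev_def f_def g_def power_N algebra_simps)
      moreover have "r ^ (N - 1) * (\<sigma> * (F r * u r)) \<le> 0"
      proof -
        have "F r * u r \<le> 0" using Fneg[OF r1] nn[of r] r1 by (intro mult_nonpos_nonneg) auto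
        from mult_nonneg_nonpos[OF sigma_nonneg this] show ?thesis
          by (rule mult_nonneg_nonpos[rotated]) (use r1 in simp)
      qed
      moreover have "r ^ N * g \<le> c / 4"
      proof -
        have "g \<le> \<bar>u r\<bar> powr (q + 1)" using q_gt_1 by (simp add: g_def divide_le_eq mult_le_cancel_left1)
        also have "\<dots> \<le> U powr (q + 1)"
          using anti[of R r] uR r R nn[of r] q_gt_1 by (intro powr_mono2) auto
        finally have "r ^ N * g \<le> (2 * R) ^ N * U powr (q + 1)"
          using r r1 q_gt_1 by (intro mult_mono power_mono) (auto simp: g_def)
        then show ?thesis using R(2) by (simp add: U_def)
      qed
      ultimately have "c / 4 \<le> r ^ N * f" using P_ge[OF r] by linarith
      also have "\<dots> \<le> (2 * R) ^ N * f" using r r1 f0 by (intro mult_right_mono power_mono) auto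
      finally have "(k + 1) * (c / 4) \<le> (k + 1) * ((2 * R) ^ N * f)" using k_gt_1 by (intro mult_left_mono) auto
      then have "(k + 1) * (c / 4) \<le> \<bar>F r\<bar> powr (k + 1) * (2 * R) ^ N"
        using k_gt_1 by (simp add: f_def mult.commute)
      then have "Z \<le> \<bar>F r\<bar> powr (k + 1)" unfolding Z_def using R by (subst pos_divide_le_eq) auto
      then have "Z powr (1 / p) \<le> (\<bar>F r\<bar> powr (k + 1)) powr (1 / p)" using Z p_gt_1 by (intro powr_mono2) auto
      also have "\<dots> = \<bar>F r\<bar> powr k"
      proof -
        have "(k + 1) * (1 / p) = k" using inverse_k_1(2) k_gt_1 p_gt_1 by (simp add: field_simps)
        then show ?thesis by (simp only: powr_powr)
      qed
      finally show ?thesis using Fneg[OF r1] by (simp add: signed_pow_nonpos)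
    qed
    \<comment> \<open>Integrating the slope over \<open>[R, 2 * R]\<close> gives
      \<open>R * Z powr (1 / p) \<le> u R \<le> U\<close>, against the choice of
      \<open>R\<close>.\<close>
    have "Z powr (1 / p) * (2 * R) - Z powr (1 / p) * R \<le> - u (2 * R) - (- u R)"
    proof (rule deriv_ge_imp_increment_ge[where f = "\<lambda>x. - u x" and h = "\<lambda>x. Z powr (1 / p) * x"])
      fix x assume x: "R < x" "x < 2 * R"
      show "((\<lambda>x. - u x) has_real_derivative - signed_pow k (F x)) (at x)"
        by (rule DERIV_minus[OF deriv_u[OF sol]]) (use x R in simp)
      show "((\<lambda>x. Z powr (1 / p) * x) has_real_derivative Z powr (1 / p)) (at x)" by (rule DERIV_cmult_Id)
      show "Z powr (1 / p) \<le> - signed_pow k (F x)" using v_ge[of x] x by simp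
    qed (use R in \<open>auto intro!: continuous_intros cont_u_Icc[OF sol]\<close>)
    then have "R * Z powr (1 / p) \<le> u R" using nn[of "2 * R"] R by (simp add: algebra_simps)
    then show False using uR R(3) by (simp add: U_def Z_def)
  qed
  then show ?thesis using eps(1) by blast
qed

subsection \<open>Existence by connectedness\<close>

text \<open>The odd power \<open>k\<close> inverts the odd power \<open>p - 1\<close>, so
  \<open>dw\<close> is eliminated in favour of the flux.\<close>

lemma ivp_solution_imp_solves:
  assumes "ivp_solution N p q \<alpha> a u"
  shows "u 0 = a" "\<exists>F. solves 1 u F"
proof -
  obtain dw dF where dw: "\<And>r. r \<ge> 0 \<Longrightarrow> (u has_real_derivative dw r) (at r within {0..})"
    and dF: "\<And>r. r \<ge> 0 \<Longrightarrow> ((\<lambda>s. signed_pow (p - 1) (dw s)) has_real_derivative dF r) (at r within {0..})"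
    and ode: "\<And>r. r > 0 \<Longrightarrow> dF r + (real N - 1) / r * signed_pow (p - 1) (dw r)
                 + r * dw r + \<alpha> * u r + signed_pow q (u r) = 0"
    and init: "u 0 = a" "dw 0 = 0"
    using assms unfolding ivp_solution_def by blast
  show "u 0 = a" by fact
  define F where "F = (\<lambda>s. signed_pow (p - 1) (dw s))"
  have inv: "signed_pow k (F r) = dw r" for r
    unfolding F_def k_def by (rule signed_pow_signed_pow) (use p_gt_1 in simp)
  have "solves 1 u F"
    unfolding solves_def
  proof (intro conjI allI impI)
    show "(u has_real_derivative signed_pow k (F r)) (at r within {0..})" if "r \<ge> 0" for r
      using dw[OF that] by (simp add: inv)
    show "continuous_on {0..} F"
      using dF unfolding F_def by (auto simp: continuous_on_eq_continuous_within intro!: DERIV_continuous)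
    show "F 0 = 0" by (simp add: F_def init signed_pow_def)
    fix r :: real assume r: "r > 0"
    have "dF r = - ((real N - 1) / r * F r) - 1 * (r * signed_pow k (F r) + \<alpha> * u r) - signed_pow q (u r)"
      using ode[OF r] unfolding inv by (simp add: F_def)
    then show "(F has_real_derivative - ((real N - 1) / r * F r) - 1 * (r * signed_pow k (F r) + \<alpha> * u r) - signed_pow q (u r)) (at r)"
      using dF[of r] r at_within_interior[of r "{0..}"] by (simp add: F_def)
  qed
  then show "\<exists>F. solves 1 u F" by blast
qed

lemma exists_fast_decaying_solution:
  assumes sol: "\<And>a. solves 1 (W a) (F a)" and init: "\<And>a. W a 0 = a"
  shows "\<exists>a>0. (\<forall>r\<ge>0. W a r > 0) \<and>
    (\<exists>c. c \<noteq> 0 \<and> ((\<lambda>r. r powr ((real N - p) / (p - 1)) * W a r) \<longlongrightarrow> c) at_top)"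
proof -
  have near: "\<forall>\<^sub>F b in nhds a. \<forall>s\<in>{0..R}. \<bar>W b s - W a s\<bar> < e \<and> \<bar>F b s - F a s\<bar> < e"
    if "R \<ge> 0" "e > 0" for a R e
  proof -
    \<comment> \<open>The bound \<open>\<bar>a\<bar> + 1\<close> covers all data within distance
      \<open>1\<close> of \<open>a\<close>, so one constant serves a whole neighbourhood.\<close>
    obtain L where L: "L > 0" "\<And>u F v G. solves 1 u F \<Longrightarrow> solves 1 v G \<Longrightarrow> \<bar>u 0\<bar> \<le> \<bar>a\<bar> + 1 \<Longrightarrow> \<bar>v 0\<bar> \<le> \<bar>a\<bar> + 1 \<Longrightarrow>
     (\<forall>r\<in>{0..R}. \<bar>u r - v r\<bar> \<le> L * \<bar>u 0 - v 0\<bar> \<and> \<bar>F r - G r\<bar> \<le> L * \<bar>u 0 - v 0\<bar>)"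
      using continuous_dependence[OF \<open>R \<ge> 0\<close>, of "\<bar>a\<bar> + 1"] by blast
    have "\<forall>\<^sub>F b in nhds a. dist b a < min 1 (e / L)"
      using L \<open>e > 0\<close> by (intro eventually_nhds_metric[THEN iffD2] exI[of _ "min 1 (e / L)"]) auto
    then show ?thesis
    proof eventually_elim
      case (elim b)
      then have b: "\<bar>b - a\<bar> < 1" "L * \<bar>b - a\<bar> < e"
        using L by (auto simp: dist_real_def field_simps)
      have "\<forall>r\<in>{0..R}. \<bar>W b r - W a r\<bar> \<le> L * \<bar>b - a\<bar> \<and> \<bar>F b r - F a r\<bar> \<le> L * \<bar>b - a\<bar>"
        using L(2)[OF sol[of b] sol[of a]] b by (simp add: init)
      with b show ?case by fastforce
    qed
  qed
  have W_lim: "((\<lambda>b. W b R) \<longlongrightarrow> W a R) (nhds a)" and F_lim: "((\<lambda>b. F b R) \<longlongrightarrow> F a R) (nhds a)"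
    if "R \<ge> 0" for a R
    using that by (auto intro!: tendstoI eventually_mono[OF near[of R _ a]] simp: dist_real_def)
  \<comment> \<open>All negative data lie in \<open>S1\<close> as well, which is why connectedness
    is used on \<open>{0<..}\<close>.\<close>
  define S1 where "S1 = {a. \<exists>r\<ge>0. W a r < 0}"
  define good where "good = (\<lambda>a R. (\<forall>s\<in>{0..R}. W a s > 0) \<and> mass 1 (W a) (F a) R > 0 \<and> W a R powr (q - 1) < real N - \<alpha>)"
  define S2 where "S2 = {a. \<exists>R>0. good a R}"
  have openI': "open S" if ev: "\<And>a. a \<in> S \<Longrightarrow> \<forall>\<^sub>F b in nhds a. b \<in> S" for S :: "real set"
  proof (subst open_subopen, intro ballI)
    fix a assume "a \<in> S"
    from ev[OF this] show "\<exists>T. open T \<and> a \<in> T \<and> T \<subseteq> S" unfolding eventually_nhds by blast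
  qed
  have "open S1"
  proof (rule openI')
    fix a assume "a \<in> S1"
    then obtain r where r: "r \<ge> 0" "W a r < 0" by (auto simp: S1_def)
    show "\<forall>\<^sub>F b in nhds a. b \<in> S1"
      using order_tendstoD(2)[OF W_lim[OF r(1)] r(2)] by eventually_elim (use r in \<open>auto simp: S1_def\<close>)
  qed
  moreover have "open S2"
  proof (rule openI')
    fix a assume "a \<in> S2"
    then obtain R where R: "R > 0" "\<And>s. s \<in> {0..R} \<Longrightarrow> W a s > 0" "mass 1 (W a) (F a) R > 0"
      "W a R powr (q - 1) < real N - \<alpha>" by (auto simp: S2_def good_def)
    \<comment> \<open>The positive minimum of \<open>W a\<close> on \<open>[0, R]\<close> is the
      tolerance that keeps nearby solutions positive there.\<close>
    obtain s0 where s0: "s0 \<in> {0..R}" "\<And>s. s \<in> {0..R} \<Longrightarrow> W a s0 \<le> W a s"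
      using continuous_attains_inf[of "{0..R}" "W a"] cont_u_Icc[OF sol, of 0 R a] R(1) by auto
    have "\<forall>\<^sub>F b in nhds a. \<forall>s\<in>{0..R}. \<bar>W b s - W a s\<bar> < W a s0 \<and> \<bar>F b s - F a s\<bar> < W a s0"
      by (rule near) (use R s0 in auto)
    moreover have "((\<lambda>b. mass 1 (W b) (F b) R) \<longlongrightarrow> mass 1 (W a) (F a) R) (nhds a)"
      unfolding mass_def using R by (intro tendsto_intros W_lim F_lim) auto
    then have "\<forall>\<^sub>F b in nhds a. mass 1 (W b) (F b) R > 0" by (rule order_tendstoD) (rule R)
    moreover have "((\<lambda>b. W b R powr (q - 1)) \<longlongrightarrow> W a R powr (q - 1)) (nhds a)"
      using R(1) R(2)[of R] by (intro tendsto_powr W_lim tendsto_const) auto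
    then have "\<forall>\<^sub>F b in nhds a. W b R powr (q - 1) < real N - \<alpha>" by (rule order_tendstoD) (rule R)
    ultimately have "\<forall>\<^sub>F b in nhds a. good b R"
    proof eventually_elim
      case (elim b)
      have "W b s > 0" if "s \<in> {0..R}" for s using elim(1) s0(2)[OF that] that by force
      with elim show ?case by (simp add: good_def)
    qed
    then show "\<forall>\<^sub>F b in nhds a. b \<in> S2" by eventually_elim (use R in \<open>auto simp: S2_def\<close>)
  qed
  moreover have S2_pos: "W a r > 0" if "a \<in> S2" "r \<ge> 0" for a r
    using that mass_criterion[OF sol, of _ a r] by (auto simp: S2_def good_def)
  then have "S1 \<inter> S2 \<inter> {0<..} = {}" by (force simp: S1_def)
  moreover have "S2 \<inter> {0<..} \<noteq> {}"
  proof -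
    define a where "a = ((real N - \<alpha>) / 2) powr (1 / (q - 1))"
    have "a > 0" "a powr (q - 1) < real N - \<alpha>" using alpha_lt q_gt_1 by (auto simp: a_def powr_powr)
    then have "a \<in> S2" using small_data_mass_pos[OF sol, of a] by (auto simp: init S2_def good_def)
    with \<open>a > 0\<close> show ?thesis by auto
  qed
  moreover have "S1 \<inter> {0<..} \<noteq> {}"
  proof -
    obtain \<epsilon> where eps: "\<epsilon> > 0" "\<And>u F. solves \<epsilon> u F \<Longrightarrow> u 0 = 1 \<Longrightarrow> \<exists>r\<ge>0. u r < 0"
      using sign_change_for_small_parameter by blast
    \<comment> \<open>Chosen so that the rescaled solution has parameter
      \<open>a powr (1 - q) = \<epsilon>\<close>.\<close>
    define a where "a = \<epsilon> powr (1 / (1 - q))"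
    have a: "a > 0" "a powr (1 - q) = \<epsilon>" using eps q_gt_1 by (auto simp: a_def powr_powr)
    define m where "m = a powr ((q + 1 - p) / p)"
    have "m > 0" using a by (simp add: m_def)
    obtain r where r: "r \<ge> 0" "W a (r / m) / a < 0"
      using eps(2)[OF rescale[OF sol init a(1) m_def refl, unfolded a(2)]] a by (auto simp: init)
    then have "a \<in> S1" using a \<open>m > 0\<close> by (auto simp: S1_def divide_less_0_iff intro!: exI[of _ "r / m"])
    with a show ?thesis by auto
  qed
  ultimately have "\<not> {0<..} \<subseteq> S1 \<union> S2"
    using connectedD[of "{0::real<..}" S1 S2] by auto
  then obtain a where a: "a > 0" "a \<notin> S1" "a \<notin> S2" by auto
  have pos: "W a r > 0" if "r \<ge> 0" for r
    by (rule nonneg_imp_pos[OF sol]) (use a that in \<open>auto simp: init S1_def not_less\<close>)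
  have "mass 1 (W a) (F a) R \<le> 0" if "R > 0" "W a R powr (q - 1) < real N - \<alpha>" for R
  proof (rule ccontr)
    assume "\<not> ?thesis"
    then have "good a R" using that pos by (auto simp: good_def)
    with \<open>R > 0\<close> a(3) show False by (auto simp: S2_def)
  qed
  from fast_decay[OF sol pos this] pos a(1) show ?thesis by blast
qed

end

theorem theorem4p9:
  fixes N :: nat and p q \<alpha> :: real and w :: "real \<Rightarrow> real \<Rightarrow> real"
  assumes "N \<ge> 1"
    and "1 < p" and "p < 2"
    and "delta_exp p < \<alpha>" and "\<alpha> < real N"
    and "1 < q" and "ereal q < q_star N p"
    and "\<And>a. ivp_solution N p q \<alpha> a (\<lambda>r. w r a)"
  shows "\<exists>a>0. (\<forall>r\<ge>0. w r a > 0) \<and>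
           (\<exists>c. c \<noteq> 0 \<and> ((\<lambda>r. r powr (eta_exp N p) * w r a) \<longlongrightarrow> c) at_top)"
proof -
  \<comment> \<open>From \<open>\<delta> > 1\<close> follows \<open>N > \<alpha> > 1\<close>, hence
    \<open>p < 2 \<le> N\<close>; so \<open>q_star\<close> has its finite value and yields the
    subcriticality assumption.\<close>
  have "1 < p / (2 - p)" using assms(2,3) by simp
  then have "N \<ge> 2" using assms(4,5) by (simp add: delta_exp_def)
  then have "p < real N" using assms(3) by simp
  then have "(real N - p) * (q + 1) < real N * p"
    using assms(7) by (simp add: q_star_def pos_less_divide_eq algebra_simps)
  then interpret emden_fowler N p q \<alpha>
    using assms by unfold_locales (auto simp: delta_exp_def)
  obtain F where "\<And>a. solves 1 (\<lambda>r. w r a) (F a)"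
    using ivp_solution_imp_solves(2)[OF assms(8)] by metis
  then show ?thesis
    using exists_fast_decaying_solution[of "\<lambda>a r. w r a" F] ivp_solution_imp_solves(1)[OF assms(8)]
    by (simp add: eta_exp_def)
qed

end
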